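(* Two states $x\in Q$, $y\in Q'$ of finitely branching regular nominal transition systems $(Q,\gamma)$, $(Q',\delta)$ are equivalent under local freshness semantics, i.e. $D(L(x))=D(L(y))$, if and only if they are behaviourally equivalent with respect to the graded semantics $({\mathbb{M}}^{\mathsf{loc}},\theta_1\cdot\alpha)$, i.e. $\gamma^{(n)}(x)=\delta^{(n)}(y)$ for all $n\in\mathbb{N}$.
   Context: Nominal sets: $\mathbb{A}$ countably infinite set of names, $G$ finite permutations of $\mathbb{A}$, $(a\,b)$ transpositions. Nominal set: set with $G$-action, every element with finite support; $a\#x$ iff $a\notin\mathsf{supp}(x)$; orbit-finite = finitely many orbits; equivariant maps commute with the action. $[\mathbb{A}]Z$: quotient of $\mathbb{A}\times Z$ by $(a,z)\sim(b,z')$ iff $(c\,a)\cdot z=(c\,b)\cdot z'$ for some fresh $c$, classes $\langle a\rangle z$. $\mathcal{P}_\omega$ finite powerset. $1=\{*\}$. Bar strings: $\overline{\mathbb{A}}=\mathbb{A}\cup\{|a\mid a\in\mathbb{A}\}$, $\pi\cdot|a=|\pi(a)$. $\equiv_\alpha$ on $\overline{\mathbb{A}}^*\times X$ ($\overline{\mathbb{A}}^*\times 1$ identified with bar strings): equivalence generated by $w\,|a\,v\equiv_\alpha w\,|b\,u$ whenever $\langle a\rangle v=\langle b\rangle u$ in $[\mathbb{A}](\overline{\mathbb{A}}^*\times X)$. $\mathsf{ub}$ removes bars ($|a\mapsto a$). For a set $L$ of $\alpha$-classes, $D(L)=\{\mathsf{ub}(w)\mid[w]_\alpha\in L\}$ (all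 representatives). Systems: $H_\omega X=\mathcal{P}_\omega(\mathbb{A}\times X)\times\mathcal{P}_\omega([\mathbb{A}]X)$. A finitely branching regular nominal transition system is an orbit-finite nominal set $Q$ with an equivariant $\gamma\colon Q\to H_\omega Q$; $q\xrightarrow{a}q'$ iff $(a,q')$ is in the first component of $\gamma(q)$, $q\xrightarrow{|a}q'$ iff $\langle a\rangle q'$ is in the second. Extend to bar strings as usual; $L(q)=\{[w]_\alpha\mid q\xrightarrow{w}q'\text{ for some }q'\}$. $M^{\mathsf{bar}}_1X=\mathcal{P}_\omega((\overline{\mathbb{A}}\times X)/{\equiv_\alpha})$ and $\alpha_X\colon H_\omega X\to M^{\mathsf{bar}}_1X$, $\alpha_X(S,T)=\{[ax]_\alpha\mid(a,x)\in S\}\cup\{[|a\,x]_\alpha\mid\langle a\rangle x\in T\}$. Graded nominal algebra for $T^{\mathsf{loc}}$: signature with pure $0$ (constant) and $+$ (binary), depth 0, free $\mathsf{pre}$ and bound $\mathsf{abs}$, unary of depth 1. Terms over a nominal set $X$: variables, $0$, $t+u$, $a.\mathsf{pre}(t)$, $\nu a.\mathsf{abs}(t)$; uniform depth: variables $0$, $0$ any depth, $+$ preserves, $\mathsf{pre},\mathsf{abs}$ add 1; $\mathsf{Term}_n(X)$ the nominal set of raw terms of uniform depth $n$. Axioms of $T^{\mathsf{loc}}$ (for each orbit-finite $Y$, $x,y,z\in Y$, $a\in\mathbb{A}$): $Y\vdash_0x+0=x$, $x+x=x$, $x+y=y+x$, $(x+y)+z=x+(y+z)$; $Y\vdash_1a.\mathsf{pre}(x+y)=a.\mathsf{pre}(x)+a.\mathsf{pre}(y)$;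 $\emptyset\vdash_1a.\mathsf{pre}(0)=0$; $Y\vdash_1\nu a.\mathsf{abs}(x+y)=\nu a.\mathsf{abs}(x)+\nu a.\mathsf{abs}(y)$; $\emptyset\vdash_1\nu a.\mathsf{abs}(0)=0$; $Y\vdash_1a.\mathsf{pre}(x)+\nu a.\mathsf{abs}(x)=\nu a.\mathsf{abs}(x)$. Derivable judgements: least set closed under (refl) $X\vdash_0x=x$; (symm); (trans); (cong) for each operation (same prefix name); (ax) instantiating an axiom $Y\vdash_mr=s$ as $X\vdash_{m+l}(\tau\cdot r)\sigma=(\tau\cdot s)\sigma$ for $\tau\in G$, $\sigma\colon Y\to\mathsf{Term}_l(X)$ with $X\vdash_l\pi\cdot\sigma(y)=\sigma(\pi\cdot y)$ derivable for all $\pi,y$ (substitution without renaming bound names); (perm) from $X\vdash_mt=(a\,b)\cdot u$, $a\ne b$, $a\#u$, infer $X\vdash_{m+1}\nu a.\mathsf{abs}(t)=\nu b.\mathsf{abs}(u)$. The graded monad ${\mathbb{M}}^{\mathsf{loc}}$ induced by $T^{\mathsf{loc}}$: $M^{\mathsf{loc}}_nX=\mathsf{Term}_n(X)/{\sim}$ ($\sim$ derivable equality, classes $[t]_n$); $M^{\mathsf{loc}}_nf([t]_n)=[t\sigma_f]_n$ with $\sigma_f(x)=f(x)$; $\eta_X(x)=[x]_0$; $\mu^{nk}_X([t]_n)=[t\sigma]_{n+k}$ for $t\in\mathsf{Term}_n(M^{\mathsf{loc}}_kX)$ and any $\sigma\colon M^{\mathsf{loc}}_kX\to\mathsf{Term}_k(X)$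 with $[\sigma(c)]_k=c$. $\theta_1\colon M^{\mathsf{bar}}_1X\to M^{\mathsf{loc}}_1X$ maps $\{[t_1]_\alpha,\dots,[t_k]_\alpha\}$ to $[t_1+\dots+t_k]_1$ ($[0]_1$ if empty), reading $ax$ as $a.\mathsf{pre}(x)$ and $|a\,x$ as $\nu a.\mathsf{abs}(x)$. For a coalgebra $\gamma\colon Q\to H_\omega Q$, the behaviour maps $\gamma^{(n)}\colon Q\to M^{\mathsf{loc}}_n1$ are $\gamma^{(0)}=M^{\mathsf{loc}}_0!\cdot\eta_Q$ and $\gamma^{(n+1)}=\mu^{1,n}_1\cdot M^{\mathsf{loc}}_1\gamma^{(n)}\cdot\theta_{1,Q}\cdot\alpha_Q\cdot\gamma$. *)

theory Defs
  imports "HOL-Combinatorics.Perm" "HOL-Library.FuncSet" "HOL-Library.Countable_Set"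
begin

unbundle permutation_syntax
datatype name = Name nat

record 'a gset =
  carrier :: "'a set"
  act :: "name perm \<Rightarrow> 'a \<Rightarrow> 'a"

definition supports :: "'a gset \<Rightarrow> name set \<Rightarrow> 'a \<Rightarrow> bool" where
  "supports X A x \<longleftrightarrow> (\<forall>\<pi>. (\<forall>a\<in>A. \<pi> \<langle>$\<rangle> a = a) \<longrightarrow> act X \<pi> x = x)"

definition supp :: "'a gset \<Rightarrow> 'a \<Rightarrow> name set" where
  "supp X x = \<Inter> {A. finite A \<and> supports X A x}"

definition fresh :: "'a gset \<Rightarrow> name \<Rightarrow> 'a \<Rightarrow> bool" where
  "fresh X a x \<longleftrightarrow> a \<notin> supp X x"

definition nominal :: "'a gset \<Rightarrow> bool" where
  "nominal X \<longleftrightarrow>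
     (\<forall>\<pi>. \<forall>x\<in>carrier X. act X \<pi> x \<in> carrier X) \<and>
     (\<forall>x\<in>carrier X. act X 1 x = x) \<and>
     (\<forall>\<pi> \<rho>. \<forall>x\<in>carrier X. act X (\<pi> * \<rho>) x = act X \<pi> (act X \<rho> x)) \<and>
     (\<forall>x\<in>carrier X. \<exists>A. finite A \<and> supports X A x)"

definition orbit_of :: "'a gset \<Rightarrow> 'a \<Rightarrow> 'a set" where
  "orbit_of X x = range (\<lambda>\<pi>. act X \<pi> x)"

definition orbit_finite :: "'a gset \<Rightarrow> bool" where
  "orbit_finite X \<longleftrightarrow> finite (orbit_of X ` carrier X)"

definition equivariant :: "'a gset \<Rightarrow> 'b gset \<Rightarrow> ('a \<Rightarrow> 'b) \<Rightarrow> bool" where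
  "equivariant X Y f \<longleftrightarrow>
     f \<in> carrier X \<rightarrow> carrier Y \<and>
     (\<forall>\<pi>. \<forall>x\<in>carrier X. f (act X \<pi> x) = act Y \<pi> (f x))"

definition One :: "unit gset" where
  "One = \<lparr>carrier = UNIV, act = (\<lambda>_ x. x)\<rparr>"

definition Names :: "name gset" where
  "Names = \<lparr>carrier = UNIV, act = (\<langle>$\<rangle>)\<rparr>"

definition Prod :: "'a gset \<Rightarrow> 'b gset \<Rightarrow> ('a \<times> 'b) gset" where
  "Prod X Y = \<lparr>carrier = carrier X \<times> carrier Y,
               act = (\<lambda>\<pi> (x, y). (act X \<pi> x, act Y \<pi> y))\<rparr>"

definition Pfin :: "'a gset \<Rightarrow> 'a set gset" where
  "Pfin X = \<lparr>carrier = {S. finite S \<and> S \<subseteq> carrier X}, act = (\<lambda>\<pi> S. act X \<pi> ` S)\<rparr>"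

definition Quot :: "'a gset \<Rightarrow> 'a rel \<Rightarrow> 'a set gset" where
  "Quot X R = \<lparr>carrier = carrier X // R, act = (\<lambda>\<pi> C. act X \<pi> ` C)\<rparr>"

definition abs_rel :: "'a gset \<Rightarrow> (name \<times> 'a) rel" where
  "abs_rel Z = {((a, z), (b, z')). z \<in> carrier Z \<and> z' \<in> carrier Z \<and>
     (\<exists>c. c \<noteq> a \<and> c \<noteq> b \<and> fresh Z c z \<and> fresh Z c z' \<and>
          act Z \<langle>c \<leftrightarrow> a\<rangle> z = act Z \<langle>c \<leftrightarrow> b\<rangle> z')}"

definition Abstr :: "'a gset \<Rightarrow> (name \<times> 'a) set gset" where
  "Abstr Z = Quot (Prod Names Z) (abs_rel Z)"

definition abs_class :: "'a gset \<Rightarrow> name \<Rightarrow> 'a \<Rightarrow> (name \<times> 'a) set" where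
  "abs_class Z a z = abs_rel Z `` {(a, z)}"

datatype letter = Fr name | Bar name

primrec letter_act :: "name perm \<Rightarrow> letter \<Rightarrow> letter" where
  "letter_act \<pi> (Fr a) = Fr (\<pi> \<langle>$\<rangle> a)"
| "letter_act \<pi> (Bar a) = Bar (\<pi> \<langle>$\<rangle> a)"

primrec ub :: "letter \<Rightarrow> name" where
  "ub (Fr a) = a"
| "ub (Bar a) = a"

definition BarStrings :: "letter list gset" where
  "BarStrings = \<lparr>carrier = UNIV, act = (\<lambda>\<pi>. map (letter_act \<pi>))\<rparr>"

text \<open>Words ending in an element of \<open>X\<close> are pairs; a bar string \<open>w\<close> is the pair \<open>(w, ())\<close> over
  \<open>One\<close>, and \<open>[s x]\<close> for a single letter \<open>s\<close> is the class of \<open>([s], x)\<close>.\<close>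

inductive alpha_step :: "'x gset \<Rightarrow> letter list \<times> 'x \<Rightarrow> letter list \<times> 'x \<Rightarrow> bool"
  for X :: "'x gset" where
  "\<lbrakk>x \<in> carrier X; y \<in> carrier X;
    abs_class (Prod BarStrings X) a (v, x) = abs_class (Prod BarStrings X) b (u, y)\<rbrakk>
   \<Longrightarrow> alpha_step X (w @ Bar a # v, x) (w @ Bar b # u, y)"

definition alpha_class :: "'x gset \<Rightarrow> letter list \<Rightarrow> 'x \<Rightarrow> (letter list \<times> 'x) set" where
  "alpha_class X w x = {p. equivclp (alpha_step X) (w, x) p}"

definition D :: "(letter list \<times> unit) set set \<Rightarrow> name list set" where
  "D L = {map ub w | w. alpha_class One w () \<in> L}"

definition H :: "'x gset \<Rightarrow> ((name \<times> 'x) set \<times> (name \<times> 'x) set set) gset" where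
  "H X = Prod (Pfin (Prod Names X)) (Pfin (Abstr X))"

type_synonym 'q coalg = "'q \<Rightarrow> (name \<times> 'q) set \<times> (name \<times> 'q) set set"

definition regular_nts :: "'q gset \<Rightarrow> 'q coalg \<Rightarrow> bool" where
  "regular_nts Q \<gamma> \<longleftrightarrow> nominal Q \<and> orbit_finite Q \<and> equivariant Q (H Q) \<gamma>"

primrec step :: "'q gset \<Rightarrow> 'q coalg \<Rightarrow> 'q \<Rightarrow> letter \<Rightarrow> 'q \<Rightarrow> bool" where
  "step Q \<gamma> q (Fr a) q' \<longleftrightarrow> q' \<in> carrier Q \<and> (a, q') \<in> fst (\<gamma> q)"
| "step Q \<gamma> q (Bar a) q' \<longleftrightarrow> q' \<in> carrier Q \<and> abs_class Q a q' \<in> snd (\<gamma> q)"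

primrec run :: "'q gset \<Rightarrow> 'q coalg \<Rightarrow> 'q \<Rightarrow> letter list \<Rightarrow> 'q \<Rightarrow> bool" where
  "run Q \<gamma> q [] q' \<longleftrightarrow> q' = q"
| "run Q \<gamma> q (s # w) q' \<longleftrightarrow> (\<exists>p. step Q \<gamma> q s p \<and> run Q \<gamma> p w q')"

definition L :: "'q gset \<Rightarrow> 'q coalg \<Rightarrow> 'q \<Rightarrow> (letter list \<times> unit) set set" where
  "L Q \<gamma> q = {alpha_class One w () | w. \<exists>q'. run Q \<gamma> q w q'}"

definition alpha ::
  "'x gset \<Rightarrow> (name \<times> 'x) set \<times> (name \<times> 'x) set set \<Rightarrow> (letter list \<times> 'x) set set" where
  "alpha X = (\<lambda>(S, T).
     {alpha_class X [Fr a] x | a x. (a, x) \<in> S} \<union>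
     {alpha_class X [Bar a] x | a x. x \<in> carrier X \<and> abs_class X a x \<in> T})"

datatype 'x trm =
    Var 'x
  | Zero
  | Plus "'x trm" "'x trm"
  | Pre name "'x trm"
  | Abs name "'x trm"

inductive uniform_depth :: "nat \<Rightarrow> 'x trm \<Rightarrow> bool" where
  "uniform_depth 0 (Var x)"
| "uniform_depth n Zero"
| "\<lbrakk>uniform_depth n t; uniform_depth n u\<rbrakk> \<Longrightarrow> uniform_depth n (Plus t u)"
| "uniform_depth n t \<Longrightarrow> uniform_depth (Suc n) (Pre a t)"
| "uniform_depth n t \<Longrightarrow> uniform_depth (Suc n) (Abs a t)"

primrec trm_act :: "(name perm \<Rightarrow> 'x \<Rightarrow> 'x) \<Rightarrow> name perm \<Rightarrow> 'x trm \<Rightarrow> 'x trm" where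
  "trm_act f \<pi> (Var x) = Var (f \<pi> x)"
| "trm_act f \<pi> Zero = Zero"
| "trm_act f \<pi> (Plus t u) = Plus (trm_act f \<pi> t) (trm_act f \<pi> u)"
| "trm_act f \<pi> (Pre a t) = Pre (\<pi> \<langle>$\<rangle> a) (trm_act f \<pi> t)"
| "trm_act f \<pi> (Abs a t) = Abs (\<pi> \<langle>$\<rangle> a) (trm_act f \<pi> t)"

primrec subst :: "('x \<Rightarrow> 'y trm) \<Rightarrow> 'x trm \<Rightarrow> 'y trm" where
  "subst \<sigma> (Var x) = \<sigma> x"
| "subst \<sigma> Zero = Zero"
| "subst \<sigma> (Plus t u) = Plus (subst \<sigma> t) (subst \<sigma> u)"
| "subst \<sigma> (Pre a t) = Pre a (subst \<sigma> t)"
| "subst \<sigma> (Abs a t) = Abs a (subst \<sigma> t)"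

definition Term :: "nat \<Rightarrow> 'x gset \<Rightarrow> 'x trm gset" where
  "Term n X = \<lparr>carrier = {t. set_trm t \<subseteq> carrier X \<and> uniform_depth n t},
               act = trm_act (act X)\<rparr>"

inductive loc_axiom :: "'y gset \<Rightarrow> nat \<Rightarrow> 'y trm \<Rightarrow> 'y trm \<Rightarrow> bool"
  for Y :: "'y gset" where
  unit: "x \<in> carrier Y \<Longrightarrow> loc_axiom Y 0 (Plus (Var x) Zero) (Var x)"
| idem: "x \<in> carrier Y \<Longrightarrow> loc_axiom Y 0 (Plus (Var x) (Var x)) (Var x)"
| comm: "\<lbrakk>x \<in> carrier Y; y \<in> carrier Y\<rbrakk> \<Longrightarrow>
    loc_axiom Y 0 (Plus (Var x) (Var y)) (Plus (Var y) (Var x))"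
| assoc: "\<lbrakk>x \<in> carrier Y; y \<in> carrier Y; z \<in> carrier Y\<rbrakk> \<Longrightarrow>
    loc_axiom Y 0 (Plus (Plus (Var x) (Var y)) (Var z)) (Plus (Var x) (Plus (Var y) (Var z)))"
| pre_plus: "\<lbrakk>x \<in> carrier Y; y \<in> carrier Y\<rbrakk> \<Longrightarrow>
    loc_axiom Y 1 (Pre a (Plus (Var x) (Var y))) (Plus (Pre a (Var x)) (Pre a (Var y)))"
| pre_zero: "carrier Y = {} \<Longrightarrow> loc_axiom Y 1 (Pre a Zero) Zero"
| abs_plus: "\<lbrakk>x \<in> carrier Y; y \<in> carrier Y\<rbrakk> \<Longrightarrow>
    loc_axiom Y 1 (Abs a (Plus (Var x) (Var y))) (Plus (Abs a (Var x)) (Abs a (Var y)))"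
| abs_zero: "carrier Y = {} \<Longrightarrow> loc_axiom Y 1 (Abs a Zero) Zero"
| pre_abs: "x \<in> carrier Y \<Longrightarrow>
    loc_axiom Y 1 (Plus (Pre a (Var x)) (Abs a (Var x))) (Abs a (Var x))"

text \<open>In rule \<open>ax\<close> the context \<open>Y\<close> ranges over the orbit-finite nominal sets with carrier in
  \<open>nat\<close>, since a rule of an inductive definition cannot quantify over types. Orbit-finite nominal
  sets are countable, so this loses nothing: lemma \<open>deriv_ax_any\<close> below is the same rule for
  contexts of arbitrary type.\<close>

inductive deriv :: "'x gset \<Rightarrow> nat \<Rightarrow> 'x trm \<Rightarrow> 'x trm \<Rightarrow> bool"
  for X :: "'x gset" where
  refl: "x \<in> carrier X \<Longrightarrow> deriv X 0 (Var x) (Var x)"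
| symm: "deriv X n t u \<Longrightarrow> deriv X n u t"
| trans: "\<lbrakk>deriv X n t u; deriv X n u v\<rbrakk> \<Longrightarrow> deriv X n t v"
| cong_zero: "deriv X n Zero Zero"
| cong_plus: "\<lbrakk>deriv X n t t'; deriv X n u u'\<rbrakk> \<Longrightarrow> deriv X n (Plus t u) (Plus t' u')"
| cong_pre: "deriv X n t t' \<Longrightarrow> deriv X (Suc n) (Pre a t) (Pre a t')"
| cong_abs: "deriv X n t t' \<Longrightarrow> deriv X (Suc n) (Abs a t) (Abs a t')"
| ax: "\<lbrakk>nominal (Y :: nat gset); orbit_finite Y; loc_axiom Y m r s;
        \<And>y. y \<in> carrier Y \<Longrightarrow> \<sigma> y \<in> carrier (Term l X);
        \<And>\<pi> y. y \<in> carrier Y \<Longrightarrow> deriv X l (act (Term l X) \<pi> (\<sigma> y)) (\<sigma> (act Y \<pi> y))\<rbrakk>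
   \<Longrightarrow> deriv X (m + l) (subst \<sigma> (act (Term m Y) \<tau> r)) (subst \<sigma> (act (Term m Y) \<tau> s))"
| perm: "\<lbrakk>u \<in> carrier (Term m X); deriv X m t (act (Term m X) \<langle>a \<leftrightarrow> b\<rangle> u);
          a \<noteq> b; fresh (Term m X) a u\<rbrakk>
   \<Longrightarrow> deriv X (Suc m) (Abs a t) (Abs b u)"

lemma countable_name_perm: "countable (UNIV :: name perm set)"
proof -
  have "inj (case_name (\<lambda>n. n))"
    by (auto simp: inj_def split: name.splits)
  then have "countable (UNIV :: (name \<times> name) set)"
    by (metis UNIV_Times_UNIV countable_SIGMA countableI)
  then have *: "countable {F :: (name \<times> name) set. finite F}"
    using countable_Collect_finite_subset by fastforce
  define G where "G \<pi> = {(a, \<pi> \<langle>$\<rangle> a) | a. \<pi> \<langle>$\<rangle> a \<noteq> a}" for \<pi> :: "name perm"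
  have "finite (G \<pi>)" for \<pi>
  proof -
    have "finite {a. \<pi> \<langle>$\<rangle> a \<noteq> a}" by transfer simp
    moreover have "G \<pi> = (\<lambda>a. (a, \<pi> \<langle>$\<rangle> a)) ` {a. \<pi> \<langle>$\<rangle> a \<noteq> a}"
      by (auto simp: G_def)
    ultimately show ?thesis by simp
  qed
  then have "countable (range G)"
    by (intro countable_subset[OF _ *]) auto
  moreover have "inj G"
  proof (rule injI, rule perm_eqI)
    fix \<pi> \<rho> a assume "G \<pi> = G \<rho>"
    then have "(a, b) \<in> G \<pi> \<longleftrightarrow> (a, b) \<in> G \<rho>" for b by simp
    then show "\<pi> \<langle>$\<rangle> a = \<rho> \<langle>$\<rangle> a" by (simp add: G_def) metis
  qed
  ultimately show ?thesis by (rule countable_image_inj_on)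
qed

lemma orbit_finite_countable:
  assumes "nominal X" "orbit_finite X"
  shows "countable (carrier X)"
proof -
  have "countable (orbit_of X x)" for x
    unfolding orbit_of_def by (intro countable_image countable_name_perm)
  then have "countable (\<Union>C\<in>orbit_of X ` carrier X. C)"
    using assms(2) by (intro countable_UN) (auto simp: orbit_finite_def intro: countable_finite)
  then have "countable (\<Union> (orbit_of X ` carrier X))" by simp
  moreover have "carrier X \<subseteq> \<Union> (orbit_of X ` carrier X)"
  proof
    fix x assume x: "x \<in> carrier X"
    then have "x = act X 1 x" using assms(1) by (simp add: nominal_def)
    then have "x \<in> orbit_of X x" unfolding orbit_of_def by blast
    with x show "x \<in> \<Union> (orbit_of X ` carrier X)" by blast
  qed
  ultimately show ?thesis using countable_subset by blast
qed

lemma orbit_finite_nat_copy: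
  assumes "nominal X" "orbit_finite X"
  obtains Y :: "nat gset" and f g where "nominal Y" "orbit_finite Y"
    "equivariant X Y f" "equivariant Y X g"
    "\<And>x. x \<in> carrier X \<Longrightarrow> g (f x) = x" "\<And>y. y \<in> carrier Y \<Longrightarrow> f (g y) = y"
proof -
  define f where "f = to_nat_on (carrier X)"
  define g where "g = the_inv_into (carrier X) f"
  define Y where "Y = \<lparr>carrier = f ` carrier X, act = (\<lambda>\<pi> n. f (act X \<pi> (g n)))\<rparr>"
  have inj: "inj_on f (carrier X)"
    unfolding f_def by (intro inj_on_to_nat_on orbit_finite_countable assms)
  have gf: "g (f x) = x" if "x \<in> carrier X" for x
    unfolding g_def using inj that by (rule the_inv_into_f_f)
  have Y: "carrier Y = f ` carrier X" "act Y \<pi> n = f (act X \<pi> (g n))" for \<pi> n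
    by (simp_all add: Y_def)
  have cl: "act X \<pi> x \<in> carrier X" if "x \<in> carrier X" for \<pi> x
    using assms(1) that by (simp add: nominal_def)
  have "supports Y A (f x)" if "supports X A x" "x \<in> carrier X" for A x
    using that by (auto simp: supports_def Y gf)
  then have "nominal Y"
    using assms(1) unfolding nominal_def by (auto simp: Y gf cl) metis
  moreover have "orbit_of Y (f x) = f ` orbit_of X x" if "x \<in> carrier X" for x
    using that by (auto simp: orbit_of_def Y gf)
  then have "orbit_of Y ` carrier Y = image f ` (orbit_of X ` carrier X)"
    by (force simp: Y image_iff)
  then have "orbit_finite Y"
    using assms(2) by (simp add: orbit_finite_def)
  moreover have "equivariant X Y f" "equivariant Y X g"
    by (auto simp: equivariant_def Y gf cl)
  ultimately show thesis
    by (rule that) (auto simp: gf Y)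
qed

lemma deriv_ax_any:
  fixes Y :: "'y gset" and X :: "'x gset"
  assumes nom: "nominal Y" and "orbit_finite Y" and ax: "loc_axiom Y m r s"
    and \<sigma>: "\<And>y. y \<in> carrier Y \<Longrightarrow> \<sigma> y \<in> carrier (Term l X)"
    and eqv: "\<And>\<pi> y. y \<in> carrier Y \<Longrightarrow> deriv X l (act (Term l X) \<pi> (\<sigma> y)) (\<sigma> (act Y \<pi> y))"
  shows "deriv X (m + l) (subst \<sigma> (act (Term m Y) \<tau> r)) (subst \<sigma> (act (Term m Y) \<tau> s))"
proof -
  obtain Z :: "nat gset" and f g where Z: "nominal Z" "orbit_finite Z"
    and f: "equivariant Y Z f" and g: "equivariant Z Y g"
    and gf: "\<And>x. x \<in> carrier Y \<Longrightarrow> g (f x) = x" and fg: "\<And>y. y \<in> carrier Z \<Longrightarrow> f (g y) = y"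
    using orbit_finite_nat_copy[OF assms(1,2)] by metis
  have fin: "f y \<in> carrier Z" if "y \<in> carrier Y" for y
    using f that by (auto simp: equivariant_def)
  have gin: "g y \<in> carrier Y" if "y \<in> carrier Z" for y
    using g that by (auto simp: equivariant_def)
  have emp: "carrier Z = {}" if "carrier Y = {}"
    using gin that by auto
  have "loc_axiom Z m (map_trm f r) (map_trm f s)"
    using ax by cases (auto simp: emp intro: loc_axiom.intros[simplified] fin)
  then have "deriv X (m + l) (subst (\<sigma> \<circ> g) (act (Term m Z) \<tau> (map_trm f r)))
                             (subst (\<sigma> \<circ> g) (act (Term m Z) \<tau> (map_trm f s)))"
  proof (rule deriv.ax[OF Z])
    show "(\<sigma> \<circ> g) y \<in> carrier (Term l X)" if "y \<in> carrier Z" for y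
      using \<sigma> gin that by simp
    show "deriv X l (act (Term l X) \<pi> ((\<sigma> \<circ> g) y)) ((\<sigma> \<circ> g) (act Z \<pi> y))"
      if "y \<in> carrier Z" for \<pi> y
      using eqv[OF gin[OF that]] g that by (simp add: equivariant_def)
  qed
  moreover have "subst (\<sigma> \<circ> g) (act (Term m Z) \<tau> (map_trm f t)) = subst \<sigma> (act (Term m Y) \<tau> t)"
    if "set_trm t \<subseteq> carrier Y" for t
  proof -
    have "g (act Z \<tau> (f y)) = act Y \<tau> y" if "y \<in> carrier Y" for y
      using f gf nom that by (metis equivariant_def nominal_def)
    then show ?thesis
      using that by (induction t) (auto simp: Term_def)
  qed
  moreover have "set_trm r \<subseteq> carrier Y" "set_trm s \<subseteq> carrier Y"
    using ax by (cases; auto)+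
  ultimately show ?thesis by simp
qed

definition deriv_rel :: "nat \<Rightarrow> 'x gset \<Rightarrow> 'x trm rel" where
  "deriv_rel n X = {(t, u). t \<in> carrier (Term n X) \<and> u \<in> carrier (Term n X) \<and> deriv X n t u}"

definition M :: "nat \<Rightarrow> 'x gset \<Rightarrow> 'x trm set gset" where
  "M n X = Quot (Term n X) (deriv_rel n X)"

definition cls :: "nat \<Rightarrow> 'x gset \<Rightarrow> 'x trm \<Rightarrow> 'x trm set" where
  "cls n X t = deriv_rel n X `` {t}"

text \<open>\<open>M_map\<close>, \<open>mu\<close> and \<open>theta1\<close> are specified on representatives. The representatives are
  fixed by choice; the derivation rules make the results independent of it (for \<open>M_map\<close>, when
  \<open>f\<close> is equivariant). In \<open>mu\<close> the inner \<open>rep\<close> is the substitution that sends each class in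
  \<open>M k X\<close> to one of its terms.\<close>

definition rep :: "'x trm set \<Rightarrow> 'x trm" where
  "rep c = (SOME t. t \<in> c)"

definition M_map :: "nat \<Rightarrow> 'y gset \<Rightarrow> ('x \<Rightarrow> 'y) \<Rightarrow> 'x trm set \<Rightarrow> 'y trm set" where
  "M_map n Y f c = cls n Y (subst (\<lambda>x. Var (f x)) (rep c))"

definition eta :: "'x gset \<Rightarrow> 'x \<Rightarrow> 'x trm set" where
  "eta X x = cls 0 X (Var x)"

definition mu :: "nat \<Rightarrow> nat \<Rightarrow> 'x gset \<Rightarrow> 'x trm set trm set \<Rightarrow> 'x trm set" where
  "mu n k X c = cls (n + k) X (subst rep (rep c))"

fun sum_trm :: "'x trm list \<Rightarrow> 'x trm" where
  "sum_trm [] = Zero"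
| "sum_trm [t] = t"
| "sum_trm (t # u # ts) = Plus t (sum_trm (u # ts))"

primrec letter_trm :: "letter \<Rightarrow> 'x \<Rightarrow> 'x trm" where
  "letter_trm (Fr a) x = Pre a (Var x)"
| "letter_trm (Bar a) x = Abs a (Var x)"

definition theta1 :: "'x gset \<Rightarrow> (letter list \<times> 'x) set set \<Rightarrow> 'x trm set" where
  "theta1 X S =
     (let ps = (SOME ps. set ps \<subseteq> UNIV \<times> carrier X \<and>
                         distinct (map (\<lambda>(s, x). alpha_class X [s] x) ps) \<and>
                         set (map (\<lambda>(s, x). alpha_class X [s] x) ps) = S)
      in cls 1 X (sum_trm (map (\<lambda>(s, x). letter_trm s x) ps)))"

primrec behaviour :: "'q gset \<Rightarrow> 'q coalg \<Rightarrow> nat \<Rightarrow> 'q \<Rightarrow> unit trm set" where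
  "behaviour Q \<gamma> 0 = (\<lambda>q. M_map 0 One (\<lambda>_. ()) (eta Q q))"
| "behaviour Q \<gamma> (Suc n) =
     (\<lambda>q. mu 1 n One (M_map 1 (M n One) (behaviour Q \<gamma> n) (theta1 Q (alpha Q (\<gamma> q)))))"

end

theory Submission
  imports Defs
begin

text \<open>Interpret a term of depth \<open>n\<close> over the one-element set by the set of words of length \<open>n\<close> that its
  bar strings produce under local freshness. All axioms and the rule \<open>perm\<close> are sound for this
  interpretation. For completeness, distributivity turns every term into a sum of bar strings, and
  the point is that if the words of a bar string \<open>w\<close> are covered by those of finitely many others,
  then already one of them, say \<open>w'\<close>, covers \<open>w\<close>, and \<open>w\<close> arises from \<open>w'\<close> by removing bars up to
  alpha-equivalence; the axiom \<open>a.pre(x) + \<nu>a.abs(x) = \<nu>a.abs(x)\<close> then makes \<open>w' + w\<close> equal to \<open>w'\<close>.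
  The same soundness over arbitrary sets of variables shows that the \<open>n\<close>-th behaviour map computes
  the words of length \<open>n\<close> of a state.\<close>

text \<open>Binding acts on strings, but \<open>Abs\<close> has to be interpreted on languages,
  which do not remember the strings that generate them. Finiteness makes this possible: the
  languages here are finite unions of sets \<open>DW w\<close>, so that some name is fresh for all
  generators at once. Every valuation of variables must therefore be shown to take such values
  (\<open>good\<close>), including the language of depth \<open>n\<close> of a state, although a
  state with a bound transition has infinitely many transitions \<open>step\<close>, one for each
  representative of the abstraction. The second invariant of valuations is equivariance: it turns
  freshness of a name for a term into invariance of the language under swaps. Behaviours live over
  \<open>One\<close>, so completeness is needed only there. Soundness is needed over
  \<open>Q\<close> and \<open>M n One\<close> as well, because \<open>M_map\<close> and
  \<open>mu\<close> pass through chosen representatives; it shows that the choices do not change the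
  language.\<close>

section \<open>Names, swaps and the action on bar strings\<close>

lemma infinite_names: "infinite (UNIV :: name set)"
proof -
  have "range Name = UNIV" by (metis name.exhaust surjI)
  moreover have "inj Name" by (simp add: inj_def)
  ultimately show ?thesis by (metis finite_imageD infinite_UNIV_nat)
qed

lemma fresh_name:
  assumes "finite (A :: name set)"
  obtains c where "c \<notin> A"
  using ex_new_if_finite[OF infinite_names assms] by blast

lemma swap_other: "x \<noteq> a \<Longrightarrow> x \<noteq> b \<Longrightarrow> \<langle>a \<leftrightarrow> b\<rangle> \<langle>$\<rangle> x = x"
  by (simp add: apply_swap_same)

lemma swap_swap: "\<langle>a \<leftrightarrow> b\<rangle> \<langle>$\<rangle> (\<langle>a \<leftrightarrow> b\<rangle> \<langle>$\<rangle> x) = x"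
  by (cases "x = a"; cases "x = b") (auto simp: swap_other)

lemma swap_mult_self: "\<langle>a \<leftrightarrow> b\<rangle> * \<langle>a \<leftrightarrow> b\<rangle> = 1"
  by (rule perm_eqI) (simp add: apply_times swap_swap)

lemma swap_conj: "\<pi> * \<langle>a \<leftrightarrow> b\<rangle> = \<langle>\<pi> \<langle>$\<rangle> a \<leftrightarrow> \<pi> \<langle>$\<rangle> b\<rangle> * \<pi>"
proof (rule perm_eqI)
  fix x
  show "(\<pi> * \<langle>a \<leftrightarrow> b\<rangle>) \<langle>$\<rangle> x = (\<langle>\<pi> \<langle>$\<rangle> a \<leftrightarrow> \<pi> \<langle>$\<rangle> b\<rangle> * \<pi>) \<langle>$\<rangle> x"
    by (cases "x = a"; cases "x = b") (auto simp: apply_times swap_other apply_inj)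
qed

lemma apply_inverse_apply: "\<pi> \<langle>$\<rangle> (inverse \<pi> \<langle>$\<rangle> a) = a" "inverse \<pi> \<langle>$\<rangle> (\<pi> \<langle>$\<rangle> a) = a"
  by (simp_all only: apply_sequence perm.right_inverse perm.left_inverse apply_one id_apply)

abbreviation wact :: "name perm \<Rightarrow> letter list \<Rightarrow> letter list" where
  "wact \<pi> \<equiv> map (letter_act \<pi>)"

lemma letter_act_one [simp]: "letter_act 1 s = s"
  by (cases s) simp_all

lemma letter_act_times: "letter_act (\<pi> * \<rho>) s = letter_act \<pi> (letter_act \<rho> s)"
  by (cases s) (simp_all add: apply_times)

lemma wact_one [simp]: "wact 1 w = w"
  by (induction w) simp_all

lemma wact_times: "wact (\<pi> * \<rho>) w = wact \<pi> (wact \<rho> w)"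
  by (simp add: letter_act_times)

lemma wact_swap_swap: "wact \<langle>a \<leftrightarrow> b\<rangle> (wact \<langle>a \<leftrightarrow> b\<rangle> w) = w"
  by (simp only: wact_times[symmetric] swap_mult_self wact_one)

lemma ub_letter_act: "ub (letter_act \<pi> s) = \<pi> \<langle>$\<rangle> (ub s)"
  by (cases s) simp_all

lemma map_ub_wact: "map ub (wact \<pi> w) = map (\<lambda>a. \<pi> \<langle>$\<rangle> a) (map ub w)"
  by (simp add: ub_letter_act)

lemma wact_idle:
  assumes "\<And>a. a \<in> ub ` set w \<Longrightarrow> \<pi> \<langle>$\<rangle> a = a"
  shows "wact \<pi> w = w"
proof (rule map_idI)
  fix s assume "s \<in> set w"
  then have "\<pi> \<langle>$\<rangle> (ub s) = ub s" using assms by blast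
  then show "letter_act \<pi> s = s" by (cases s) simp_all
qed

section \<open>Alpha-equivalence by de Bruijn levels\<close>

text \<open>Bound occurrences become their binding level (\<open>Inl\<close>), free ones keep their name (\<open>Inr\<close>), and
  a bar becomes \<open>None\<close>; this makes alpha-equivalence the kernel of a map.\<close>

primrec db :: "(name \<Rightarrow> nat + name) \<Rightarrow> nat \<Rightarrow> letter list \<Rightarrow> (nat + name) option list" where
  "db e k [] = []"
| "db e k (s # w) =
     (case s of Fr a \<Rightarrow> Some (e a) # db e k w | Bar a \<Rightarrow> None # db (e(a := Inl k)) (Suc k) w)"

definition aeq :: "letter list \<Rightarrow> letter list \<Rightarrow> bool" where
  "aeq w w' \<longleftrightarrow> db Inr 0 w = db Inr 0 w'"

primrec FN :: "letter list \<Rightarrow> name set" where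
  "FN [] = {}"
| "FN (s # w) = (case s of Fr a \<Rightarrow> insert a (FN w) | Bar a \<Rightarrow> FN w - {a})"

lemma aeq_refl [simp]: "aeq w w" and aeq_sym: "aeq w w' \<Longrightarrow> aeq w' w"
  and aeq_trans: "aeq w w' \<Longrightarrow> aeq w' w'' \<Longrightarrow> aeq w w''"
  by (simp_all add: aeq_def)

lemma length_db [simp]: "length (db e k w) = length w"
  by (induction w arbitrary: e k) (auto split: letter.split)

lemma aeq_length: "aeq w w' \<Longrightarrow> length w = length w'"
  by (metis aeq_def length_db)

text \<open>Levels from \<open>k\<close> on are created inside the word, so \<open>g\<close> must
  shift them to those from \<open>k'\<close> on. On names and on lower levels \<open>g\<close> may
  be arbitrary, since these enter only through \<open>e\<close>.\<close>

lemma db_rename: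
  assumes "\<And>i. g (Inl (k + i)) = Inl (k' + i)"
  shows "map (map_option g) (db e k w) = db (g \<circ> e) k' w"
  using assms
proof (induction w arbitrary: e k k')
  case (Cons s w)
  show ?case
  proof (cases s)
    case (Bar a)
    have "(g \<circ> e)(a := Inl k') = g \<circ> (e(a := Inl k))"
      using Cons.prems[of 0] by auto
    moreover have "map (map_option g) (db (e(a := Inl k)) (Suc k) w) =
        db (g \<circ> (e(a := Inl k))) (Suc k') w"
      using Cons.prems[of "Suc _"] by (intro Cons.IH) simp
    ultimately show ?thesis by (simp only: Bar db.simps letter.case list.map option.map)
  qed (use Cons in auto)
qed simp

text \<open>The code under \<open>Inr\<close> already determines the code under every environment.
  Hence \<open>aeq\<close> words have equal codes everywhere, which makes \<open>aeq\<close> a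
  congruence and invariant under permutations.\<close>

lemma db_via_Inr: "db e k w = map (map_option (case_sum (\<lambda>i. Inl (k + i)) e)) (db Inr 0 w)"
proof -
  have "map (map_option (case_sum (\<lambda>i. Inl (k + i)) e)) (db Inr 0 w) =
      db (case_sum (\<lambda>i. Inl (k + i)) e \<circ> Inr) k w"
    by (rule db_rename) simp
  moreover have "case_sum (\<lambda>i. Inl (k + i)) e \<circ> Inr = e" by (rule ext) simp
  ultimately show ?thesis by (simp only:)
qed

lemma db_cong_FN: "(\<And>a. a \<in> FN w \<Longrightarrow> e a = e' a) \<Longrightarrow> db e k w = db e' k w"
proof (induction w arbitrary: e e' k)
  case (Cons s w)
  show ?case
  proof (cases s)
    case (Fr a)
    then have "db e k w = db e' k w" by (intro Cons.IH Cons.prems) simp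
    then show ?thesis using Fr Cons.prems[of a] by simp
  next
    case (Bar a)
    have "db (e(a := Inl k)) (Suc k) w = db (e'(a := Inl k)) (Suc k) w"
    proof (rule Cons.IH)
      show "(e(a := Inl k)) b = (e'(a := Inl k)) b" if "b \<in> FN w" for b
        using Cons.prems[of b] Bar that by (cases "b = a") simp_all
    qed
    then show ?thesis using Bar by simp
  qed
qed simp

lemma db_wact: "db e k (wact \<pi> w) = db (\<lambda>a. e (\<pi> \<langle>$\<rangle> a)) k w"
proof (induction w arbitrary: e k)
  case (Cons s w)
  have "(\<lambda>b. (e(\<pi> \<langle>$\<rangle> a := Inl k)) (\<pi> \<langle>$\<rangle> b)) = (\<lambda>b. e (\<pi> \<langle>$\<rangle> b))(a := Inl k)" for a
    by (auto simp: apply_inj)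
  then show ?case
    using Cons.IH by (cases s) (simp_all only: list.map db.simps letter_act.simps letter.case)
qed simp

lemma aeq_wact: "aeq w w' \<Longrightarrow> aeq (wact \<pi> w) (wact \<pi> w')"
  unfolding aeq_def db_wact by (metis db_via_Inr)

lemma FN_db: "Some (Inr a) \<in> set (db e k w) \<longleftrightarrow> (\<exists>b\<in>FN w. e b = Inr a)"
proof (induction w arbitrary: e k)
  case (Cons s w)
  then show ?case by (cases s) (auto split: if_splits)
qed simp

lemma aeq_FN: "aeq w w' \<Longrightarrow> FN w = FN w'"
  unfolding aeq_def using FN_db[of _ Inr 0 w] FN_db[of _ Inr 0 w'] by auto

lemma FN_wact: "FN (wact \<pi> w) = (\<lambda>a. \<pi> \<langle>$\<rangle> a) ` FN w"
proof (induction w)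
  case (Cons s w)
  then show ?case by (cases s) (auto simp: apply_inj)
qed simp

lemma FN_names: "FN w \<subseteq> ub ` set w"
proof (induction w)
  case (Cons s w)
  then show ?case by (cases s) auto
qed simp

lemma finite_FN [simp]: "finite (FN w)"
  using FN_names finite_subset by blast

lemma aeq_Nil [simp]: "aeq [] w \<longleftrightarrow> w = []"
  by (cases w) (auto simp: aeq_def split: letter.split)

lemma aeq_Fr: "aeq (Fr a # w) v \<longleftrightarrow> (\<exists>w'. v = Fr a # w' \<and> aeq w w')"
  by (cases v) (auto simp: aeq_def split: letter.split)

lemma aeq_Bar_cong: "aeq w w' \<Longrightarrow> aeq (Bar a # w) (Bar a # w')"
  unfolding aeq_def by simp (metis db_via_Inr)

lemma aeq_Cons: "aeq w w' \<Longrightarrow> aeq (s # w) (s # w')"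
  by (cases s) (auto simp: aeq_Fr aeq_Bar_cong)

lemma aeq_append: "aeq w w' \<Longrightarrow> aeq (v @ w) (v @ w')"
  by (induction v) (auto intro: aeq_Cons)

text \<open>The swap sends \<open>b\<close> to \<open>a\<close>, so the bound occurrences stay
  bound; the only name that could be captured is \<open>a\<close> itself, which is not free in
  \<open>w\<close>.\<close>

lemma aeq_Bar_swap:
  assumes "a \<notin> FN w"
  shows "aeq (Bar a # wact \<langle>a \<leftrightarrow> b\<rangle> w) (Bar b # w)"
proof -
  have "db (\<lambda>x. (Inr(a := Inl 0)) (\<langle>a \<leftrightarrow> b\<rangle> \<langle>$\<rangle> x)) 1 w = db (Inr(b := Inl 0)) 1 w"
  proof (rule db_cong_FN)
    fix x assume "x \<in> FN w"
    with assms have "x \<noteq> a" by auto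
    then show "(Inr(a := Inl 0)) (\<langle>a \<leftrightarrow> b\<rangle> \<langle>$\<rangle> x) = (Inr(b := Inl 0)) x"
      by (cases "x = b") (auto simp: swap_other)
  qed
  then show ?thesis by (simp only: aeq_def db_wact db.simps letter.case One_nat_def)
qed

lemma aeq_BarE:
  assumes "aeq (Bar a # w) v"
  obtains b w' where "v = Bar b # w'"
    "\<And>c. c \<notin> FN w \<Longrightarrow> c \<notin> FN w' \<Longrightarrow> aeq (wact \<langle>c \<leftrightarrow> a\<rangle> w) (wact \<langle>c \<leftrightarrow> b\<rangle> w')"
proof -
  from assms obtain b w' where v: "v = Bar b # w'"
    and eq: "db (Inr(a := Inl 0)) 1 w = db (Inr(b := Inl 0)) 1 w'"
  proof (cases v)
    case (Cons s u)
    with assms that show thesis by (cases s) (simp_all add: aeq_def)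
  qed (use assms in \<open>simp add: aeq_def\<close>)
  have "aeq (wact \<langle>c \<leftrightarrow> a\<rangle> w) (wact \<langle>c \<leftrightarrow> b\<rangle> w')" if c: "c \<notin> FN w" "c \<notin> FN w'" for c
  proof -
    \<comment> \<open>\<open>g\<close> undoes the outermost binding: level 0 becomes the free name
      \<open>c\<close>, and the other levels drop by one.\<close>
    define g :: "nat + name \<Rightarrow> nat + name"
      where "g = case_sum (\<lambda>i. if i = 0 then Inr c else Inl (i - 1)) Inr"
    have *: "map (map_option g) (db (Inr(x := Inl 0)) 1 u) = db Inr 0 (wact \<langle>c \<leftrightarrow> x\<rangle> u)"
      if "c \<notin> FN u" for x u
    proof -
      have "map (map_option g) (db (Inr(x := Inl 0)) 1 u) = db (g \<circ> (Inr(x := Inl 0))) 0 u"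
        by (rule db_rename) (simp add: g_def)
      also have "\<dots> = db (\<lambda>y. Inr (\<langle>c \<leftrightarrow> x\<rangle> \<langle>$\<rangle> y)) 0 u"
      proof (rule db_cong_FN)
        fix y assume "y \<in> FN u"
        with that have "y \<noteq> c" by auto
        then show "(g \<circ> (Inr(x := Inl 0))) y = Inr (\<langle>c \<leftrightarrow> x\<rangle> \<langle>$\<rangle> y)"
          by (cases "y = x") (auto simp: g_def swap_other)
      qed
      finally show ?thesis by (simp add: db_wact)
    qed
    show ?thesis unfolding aeq_def *[OF c(1), symmetric] *[OF c(2), symmetric] eq ..
  qed
  with v show thesis by (rule that)
qed

text \<open>In the \<open>Bar\<close> case the hypothesis concerns the renamed bodies, hence
  induction on the length. The name \<open>c\<close> avoids all names that occur, bound ones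
  included, because freshness for raw terms and for bar strings counts these too.\<close>

lemma aeq_induct [consumes 1, case_names Nil Fr Bar]:
  assumes "aeq w w'"
    and "P [] []"
    and "\<And>a w w'. aeq w w' \<Longrightarrow> P w w' \<Longrightarrow> P (Fr a # w) (Fr a # w')"
    and "\<And>a b c w w'. \<lbrakk>c \<notin> ub ` set w; c \<notin> ub ` set w'; c \<noteq> a; c \<noteq> b;
           aeq (wact \<langle>c \<leftrightarrow> a\<rangle> w) (wact \<langle>c \<leftrightarrow> b\<rangle> w');
           P (wact \<langle>c \<leftrightarrow> a\<rangle> w) (wact \<langle>c \<leftrightarrow> b\<rangle> w')\<rbrakk> \<Longrightarrow> P (Bar a # w) (Bar b # w')"
  shows "P w w'"
  using assms(1)
proof (induction "length w" arbitrary: w w')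
  case 0
  then show ?case using assms(2) by simp
next
  case (Suc n)
  then obtain s v where w: "w = s # v" and n: "n = length v" by (cases w) auto
  show ?case
  proof (cases s)
    case (Fr a)
    with Suc.prems w obtain v' where "w' = Fr a # v'" "aeq v v'" by (auto simp: aeq_Fr)
    with assms(3) Suc.hyps(1)[OF n] w Fr show ?thesis by simp
  next
    case (Bar a)
    with Suc.prems w have "aeq (Bar a # v) w'" by simp
    then obtain b v' where w': "w' = Bar b # v'" and
      c: "\<And>c. c \<notin> FN v \<Longrightarrow> c \<notin> FN v' \<Longrightarrow> aeq (wact \<langle>c \<leftrightarrow> a\<rangle> v) (wact \<langle>c \<leftrightarrow> b\<rangle> v')"
      by (rule aeq_BarE) (rule that)
    obtain c where new: "c \<notin> ub ` set v \<union> ub ` set v' \<union> {a, b}"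
      by (rule fresh_name[of "ub ` set v \<union> ub ` set v' \<union> {a, b}"]) auto
    then have eq: "aeq (wact \<langle>c \<leftrightarrow> a\<rangle> v) (wact \<langle>c \<leftrightarrow> b\<rangle> v')"
      using FN_names by (intro c) blast+
    moreover have "P (wact \<langle>c \<leftrightarrow> a\<rangle> v) (wact \<langle>c \<leftrightarrow> b\<rangle> v')"
      using eq by (rule Suc.hyps(1)[rotated]) (simp add: n)
    ultimately have "P (Bar a # v) (Bar b # v')"
      using new by (intro assms(4)[of c]) auto
    then show ?thesis by (simp add: w w' Bar)
  qed
qed

section \<open>Languages of bar strings under local freshness\<close>

text \<open>This is \<open>D\<close> of the single alpha-class of \<open>w\<close>, once
  alpha-equivalence is known to coincide with \<open>aeq\<close>.\<close>

definition DW :: "letter list \<Rightarrow> name list set" where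
  "DW w = map ub ` {w'. aeq w w'}"

lemma DW_self: "map ub w \<in> DW w"
  by (simp add: DW_def)

lemma DW_aeq: "aeq w w' \<Longrightarrow> DW w = DW w'"
  by (simp add: DW_def aeq_def)

lemma DW_Nil [simp]: "DW [] = {[]}"
  by (auto simp: DW_def)

lemma DW_Fr: "DW (Fr a # w) = (#) a ` DW w"
proof -
  have "{w'. aeq (Fr a # w) w'} = (#) (Fr a) ` {w'. aeq w w'}" by (auto simp: aeq_Fr)
  then show ?thesis by (simp add: DW_def image_image)
qed

lemma DW_length: "v \<in> DW w \<Longrightarrow> length v = length w"
  by (auto simp: DW_def dest: aeq_length)

lemma Cons_DW_subset: "(#) a ` DW w \<subseteq> DW (Bar a # w)"
proof
  fix v assume "v \<in> (#) a ` DW w"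
  then obtain w' where "v = a # map ub w'" "aeq w w'" by (auto simp: DW_def)
  then show "v \<in> DW (Bar a # w)"
    unfolding DW_def by (intro image_eqI[of _ _ "Bar a # w'"]) (auto intro: aeq_Bar_cong)
qed

abbreviation lact :: "name perm \<Rightarrow> name list set \<Rightarrow> name list set" where
  "lact \<pi> U \<equiv> map (\<lambda>a. \<pi> \<langle>$\<rangle> a) ` U"

lemma lact_times: "lact (\<pi> * \<rho>) U = lact \<pi> (lact \<rho> U)"
  by (simp add: image_image apply_times comp_def)

lemma lact_one [simp]: "lact 1 U = U"
  by simp

lemma lact_DW: "lact \<pi> (DW w) = DW (wact \<pi> w)"
proof -
  have sub: "lact \<pi> (DW w) \<subseteq> DW (wact \<pi> w)" for \<pi> w
  proof
    fix v assume "v \<in> lact \<pi> (DW w)"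
    then obtain w' where "aeq w w'" "v = map ub (wact \<pi> w')"
      unfolding DW_def map_ub_wact by auto
    then show "v \<in> DW (wact \<pi> w)" unfolding DW_def using aeq_wact by blast
  qed
  have "DW (wact \<pi> w) = lact \<pi> (lact (inverse \<pi>) (DW (wact \<pi> w)))"
    by (simp only: lact_times[symmetric] perm.right_inverse lact_one)
  also have "\<dots> \<subseteq> lact \<pi> (DW (wact (inverse \<pi>) (wact \<pi> w)))"
    by (intro image_mono sub)
  also have "wact (inverse \<pi>) (wact \<pi> w) = w"
    by (simp only: wact_times[symmetric] perm.left_inverse wact_one)
  finally show ?thesis using sub by blast
qed

section \<open>Removing bars and inclusion of languages\<close>

text \<open>The first argument is the one with fewer bars. Names are compared literally, without
  alpha-renaming.\<close>

definition unbar :: "letter list \<Rightarrow> letter list \<Rightarrow> bool" where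
  "unbar = list_all2 (\<lambda>s s'. ub s = ub s' \<and> (\<forall>a. s' = Fr a \<longrightarrow> s = Fr a))"

lemma unbar_Nil [simp]: "unbar [] w \<longleftrightarrow> w = []"
  by (simp add: unbar_def)

lemma unbar_Fr: "unbar (Fr a # w) v \<longleftrightarrow>
    (\<exists>w'. (v = Fr a # w' \<or> v = Bar a # w') \<and> unbar w w')"
proof -
  have "ub (Fr a) = ub s \<and> (\<forall>b. s = Fr b \<longrightarrow> Fr a = Fr b) \<longleftrightarrow> s = Fr a \<or> s = Bar a" for s
    by (cases s) auto
  then show ?thesis unfolding unbar_def list_all2_Cons1 by auto
qed

lemma unbar_Bar: "unbar (Bar a # w) v \<longleftrightarrow> (\<exists>w'. v = Bar a # w' \<and> unbar w w')"
proof -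
  have "ub (Bar a) = ub s \<and> (\<forall>b. s = Fr b \<longrightarrow> Bar a = Fr b) \<longleftrightarrow> s = Bar a" for s
    by (cases s) auto
  then show ?thesis unfolding unbar_def list_all2_Cons1 by auto
qed

lemma unbar_FN: "unbar w w' \<Longrightarrow> FN w' \<subseteq> FN w"
proof (induction w arbitrary: w')
  case (Cons s w)
  then show ?case by (cases s) (fastforce simp: unbar_Fr unbar_Bar)+
qed simp

text \<open>An alpha-variant of \<open>w\<close> can be barred at the positions where
  \<open>w'\<close> has bars and \<open>w\<close> has none; this gives an alpha-variant of
  \<open>w'\<close> with unchanged underlying names. The extra bars consume levels, hence the
  separate counter and environments for the barred words. Injectivity and the bounds by
  \<open>k\<close> keep the last premise alive through each binding: names matched by
  \<open>e\<close> and \<open>e\<^sub>1\<close> stay matched by \<open>e'\<close> and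
  \<open>e\<^sub>1'\<close>.\<close>

lemma db_unbar:
  assumes "unbar w w'" "db e k w = db e\<^sub>1 k w\<^sub>1"
    and "inj e" "inj e\<^sub>1" "\<And>x i. e x = Inl i \<Longrightarrow> i < k" "\<And>x i. e\<^sub>1 x = Inl i \<Longrightarrow> i < k"
    and "\<And>x y. e x = e\<^sub>1 y \<Longrightarrow> e' x = e\<^sub>1' y"
  shows "\<exists>w\<^sub>1'. map ub w\<^sub>1' = map ub w\<^sub>1 \<and> db e' k' w' = db e\<^sub>1' k' w\<^sub>1'"
  using assms
proof (induction w arbitrary: w' w\<^sub>1 e e\<^sub>1 e' e\<^sub>1' k k')
  case Nil
  then have "w' = []" "w\<^sub>1 = []" by (simp, metis length_db length_0_conv db.simps(1))
  then show ?case by simp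
next
  case (Cons s w)
  note prems = Cons.prems
  show ?case
  proof (cases s)
    case (Fr a)
    then obtain b v where w\<^sub>1: "w\<^sub>1 = Fr b # v" and ab: "e a = e\<^sub>1 b"
      and eq: "db e k w = db e\<^sub>1 k v"
      using prems(2) by (cases w\<^sub>1) (auto split: letter.splits)
    obtain v' where w': "w' = Fr a # v' \<or> w' = Bar a # v'" and v': "unbar w v'"
      using prems(1) Fr by (auto simp: unbar_Fr)
    from w' show ?thesis
    proof
      assume w': "w' = Fr a # v'"
      have "\<exists>v\<^sub>1'. map ub v\<^sub>1' = map ub v \<and> db e' k' v' = db e\<^sub>1' k' v\<^sub>1'"
        by (rule Cons.IH[OF v' eq prems(3,4)]) (fact prems(5-7))+
      then obtain v\<^sub>1' where "map ub v\<^sub>1' = map ub v" "db e' k' v' = db e\<^sub>1' k' v\<^sub>1'"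
        by blast
      then show ?thesis using w' w\<^sub>1 ab prems(7)
        by (intro exI[of _ "Fr b # v\<^sub>1'"]) auto
    next
      assume w': "w' = Bar a # v'"
      \<comment> \<open>\<open>a\<close> and \<open>b\<close> carry the same code, and by
        injectivity neither is matched with any other name; binding both to the new level therefore
        keeps matched names matched.\<close>
      have upd: "(e'(a := Inl k')) x = (e\<^sub>1'(b := Inl k')) y" if "e x = e\<^sub>1 y" for x y
      proof (cases "x = a")
        case True
        with ab that have "y = b" using prems(4) by (metis injD)
        with True show ?thesis by simp
      next
        case False
        with ab that have "y \<noteq> b" using prems(3) by (metis injD)
        with False prems(7)[OF that] show ?thesis by simp
      qed
      have "\<exists>v\<^sub>1'. map ub v\<^sub>1' = map ub v \<and>
          db (e'(a := Inl k')) (Suc k') v' = db (e\<^sub>1'(b := Inl k')) (Suc k') v\<^sub>1'"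
        by (rule Cons.IH[OF v' eq prems(3,4)]) (fact prems(5,6) upd)+
      then obtain v\<^sub>1' where "map ub v\<^sub>1' = map ub v"
        "db (e'(a := Inl k')) (Suc k') v' = db (e\<^sub>1'(b := Inl k')) (Suc k') v\<^sub>1'"
        by blast
      then show ?thesis using w' w\<^sub>1
        by (intro exI[of _ "Bar b # v\<^sub>1'"]) auto
    qed
  next
    case (Bar a)
    then obtain b v where w\<^sub>1: "w\<^sub>1 = Bar b # v"
      and eq: "db (e(a := Inl k)) (Suc k) w = db (e\<^sub>1(b := Inl k)) (Suc k) v"
      using prems(2) by (cases w\<^sub>1) (auto split: letter.splits)
    obtain v' where w': "w' = Bar a # v'" and v': "unbar w v'"
      using prems(1) Bar by (auto simp: unbar_Bar)
    \<comment> \<open>Level \<open>k\<close> is not in use yet, so binding to it preserves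
      injectivity, and names matched afterwards are either \<open>a\<close> and \<open>b\<close> or
      were matched before.\<close>
    have new: "e x \<noteq> Inl k" "e\<^sub>1 x \<noteq> Inl k" for x
      using prems(5,6) by blast+
    have injs: "inj (e(a := Inl k))" "inj (e\<^sub>1(b := Inl k))"
      using prems(3,4) new by (auto simp: inj_def) metis+
    have less: "(e(a := Inl k)) x = Inl i \<Longrightarrow> i < Suc k"
      "(e\<^sub>1(b := Inl k)) x = Inl i \<Longrightarrow> i < Suc k" for x i
      using prems(5,6) by (auto split: if_splits intro: less_SucI)
    have upd: "(e(a := Inl k)) x = (e\<^sub>1(b := Inl k)) y \<Longrightarrow>
        (e'(a := Inl k')) x = (e\<^sub>1'(b := Inl k')) y" for x y
      using prems(7)[of x y] new(1)[of x] new(2)[of y] by (cases "x = a"; cases "y = b") auto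
    have "\<exists>v\<^sub>1'. map ub v\<^sub>1' = map ub v \<and>
        db (e'(a := Inl k')) (Suc k') v' = db (e\<^sub>1'(b := Inl k')) (Suc k') v\<^sub>1'"
      by (rule Cons.IH[OF v' eq injs]) (fact less upd)+
    then obtain v\<^sub>1' where "map ub v\<^sub>1' = map ub v"
        "db (e'(a := Inl k')) (Suc k') v' = db (e\<^sub>1'(b := Inl k')) (Suc k') v\<^sub>1'"
      by blast
    then show ?thesis using w' w\<^sub>1
      by (intro exI[of _ "Bar b # v\<^sub>1'"]) auto
  qed
qed

lemma unbar_DW:
  assumes "unbar w w'"
  shows "DW w \<subseteq> DW w'"
proof
  fix v assume "v \<in> DW w"
  then obtain w\<^sub>1 where v: "v = map ub w\<^sub>1" and "db Inr 0 w = db Inr 0 w\<^sub>1"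
    by (auto simp: DW_def aeq_def)
  from db_unbar[OF assms this(2), of Inr Inr 0]
  obtain w\<^sub>1' where "map ub w\<^sub>1' = map ub w\<^sub>1" "db Inr 0 w' = db Inr 0 w\<^sub>1'"
    by auto
  with v show "v \<in> DW w'" unfolding DW_def aeq_def by (metis (mono_tags) image_eqI mem_Collect_eq)
qed

text \<open>The syntactic counterpart of \<open>DW w \<subseteq> DW w'\<close>:
  \<open>wle_DW\<close> is one direction, and \<open>DW_subset_UN\<close> for a single generator is
  the other. Renaming is allowed on both sides so that representatives with the same underlying
  names can be compared.\<close>

definition wle :: "letter list \<Rightarrow> letter list \<Rightarrow> bool" where
  "wle w w' \<longleftrightarrow> (\<exists>v v'. aeq w v \<and> unbar v v' \<and> aeq v' w')"

lemma wle_DW: "wle w w' \<Longrightarrow> DW w \<subseteq> DW w'"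
  unfolding wle_def using DW_aeq unbar_DW by metis

lemma wle_FN: "wle w w' \<Longrightarrow> FN w' \<subseteq> FN w"
  unfolding wle_def using aeq_FN unbar_FN by metis

lemma wle_Bar: "wle w w' \<Longrightarrow> wle (Bar a # w) (Bar a # w')"
  unfolding wle_def by (metis aeq_Bar_cong unbar_Bar)

primrec clean :: "name set \<Rightarrow> letter list \<Rightarrow> bool" where
  "clean A [] \<longleftrightarrow> True"
| "clean A (s # w) \<longleftrightarrow> (\<forall>a. s = Bar a \<longrightarrow> a \<notin> A) \<and> clean (insert (ub s) A) w"

text \<open>Bars are renamed from left to right, each to a name that is also not free in the rest.
  Renaming changes the rest of the word, hence induction on the length.\<close>

lemma aeq_clean: "finite A \<Longrightarrow> \<exists>w'. aeq w w' \<and> clean A w'"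
proof (induction "length w" arbitrary: w A)
  case 0
  then show ?case by (intro exI[of _ "[]"]) simp
next
  case (Suc n)
  then obtain s v where w: "w = s # v" and n: "n = length v" by (cases w) auto
  show ?case
  proof (cases s)
    case (Fr a)
    from Suc.hyps(1)[OF n, of "insert a A"] Suc.prems
    obtain v' where "aeq v v'" "clean (insert a A) v'" by auto
    then show ?thesis using w Fr by (intro exI[of _ "Fr a # v'"]) (simp add: aeq_Fr)
  next
    case (Bar a)
    obtain c where c: "c \<notin> A \<union> FN v"
      by (rule fresh_name[of "A \<union> FN v"]) (use Suc.prems in auto)
    from Suc.hyps(1)[of "wact \<langle>c \<leftrightarrow> a\<rangle> v" "insert c A"] Suc.prems n
    obtain v' where v': "aeq (wact \<langle>c \<leftrightarrow> a\<rangle> v) v'" "clean (insert c A) v'" by auto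
    have "aeq (Bar a # v) (Bar c # wact \<langle>c \<leftrightarrow> a\<rangle> v)"
      using c by (intro aeq_sym[OF aeq_Bar_swap]) auto
    also have "aeq \<dots> (Bar c # v')" using v'(1) by (rule aeq_Bar_cong)
    finally (aeq_trans) show ?thesis using v'(2) c w Bar by (intro exI[of _ "Bar c # v'"]) auto
  qed
qed

text \<open>At a bar of \<open>w\<close> the name has not occurred before, so no earlier bar of
  \<open>w'\<close> can bind it: an unbarred letter of \<open>w'\<close> at this position would be a
  free occurrence outside \<open>A\<close>.\<close>

lemma clean_unbar:
  "clean A w \<Longrightarrow> FN w' \<subseteq> A \<Longrightarrow> map ub w = map ub w' \<Longrightarrow> unbar w w'"
proof (induction w arbitrary: A w')
  case (Cons s w)
  then obtain s' v' where w': "w' = s' # v'" "ub s' = ub s" "map ub w = map ub v'" by auto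
  have "FN v' \<subseteq> insert (ub s) A" using w' Cons.prems(2) by (cases s') auto
  then have "unbar w v'" using Cons w' by auto
  then show ?case using w' Cons.prems(1,2)
    by (cases s; cases s') (auto simp: unbar_Fr unbar_Bar)
qed simp

text \<open>Take a representative of \<open>w\<close> whose bars bind names not occurring earlier and not free in \<open>W\<close>.
  A representative of a word in \<open>W\<close> with the same underlying names cannot have these names free, so
  it has a bar wherever the representative of \<open>w\<close> has one.\<close>

lemma DW_subset_UN:
  assumes "DW w \<subseteq> (\<Union>w'\<in>W. DW w')" "finite W"
  obtains w' where "w' \<in> W" "wle w w'"
proof -
  obtain v where v: "aeq w v" "clean (\<Union>w'\<in>W. FN w') v"
    using aeq_clean[of "\<Union>w'\<in>W. FN w'" w] assms(2) by auto
  then have "map ub v \<in> DW w" using DW_self DW_aeq by metis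
  then obtain w' v' where w': "w' \<in> W" "aeq w' v'" "map ub v = map ub v'"
    using assms(1) by (auto simp: DW_def)
  then have "FN v' \<subseteq> (\<Union>w'\<in>W. FN w')" using aeq_FN by blast
  with v w' have "wle w w'" unfolding wle_def using clean_unbar aeq_sym by blast
  with w'(1) show thesis by (rule that)
qed

section \<open>Finite unions of bar string languages and binding\<close>

text \<open>These are exactly the languages \<open>sem1 t\<close> of terms over \<open>One\<close>,
  whether of uniform depth or not.\<close>

definition good :: "name list set \<Rightarrow> bool" where
  "good U \<longleftrightarrow> (\<exists>W. finite W \<and> U = (\<Union>w\<in>W. DW w))"

lemma good_DW: "good (DW w)"
  unfolding good_def by (rule exI[of _ "{w}"]) simp

lemma good_empty: "good {}"
  unfolding good_def by (rule exI[of _ "{}"]) simp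

lemma good_Un: "good U \<Longrightarrow> good V \<Longrightarrow> good (U \<union> V)"
  unfolding good_def by (metis UN_Un finite_UnI)

lemma good_Cons: "good U \<Longrightarrow> good ((#) a ` U)"
proof -
  assume "good U"
  then obtain W where "finite W" "U = (\<Union>w\<in>W. DW w)" by (auto simp: good_def)
  then show ?thesis unfolding good_def
    by (intro exI[of _ "(#) (Fr a) ` W"]) (auto simp: DW_Fr)
qed

text \<open>The interpretation of \<open>\<nu>a.abs\<close>. To be additive, it must bind the name \<open>a\<close> in each string of \<open>U\<close> separately:
  a name fresh for one summand of \<open>U\<close> need not be fresh for \<open>U\<close>.\<close>

definition absL :: "name \<Rightarrow> name list set \<Rightarrow> name list set" where
  "absL a U = \<Union> {DW (Bar a # w) | w. DW w \<subseteq> U}"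

text \<open>A string below a finite union is below one generator by \<open>DW_subset_UN\<close>, and
  \<open>wle\<close> survives putting the same bar in front.\<close>

lemma absL_UN:
  assumes "finite W"
  shows "absL a (\<Union>w\<in>W. DW w) = (\<Union>w\<in>W. DW (Bar a # w))"
proof
  show "absL a (\<Union>w\<in>W. DW w) \<subseteq> (\<Union>w\<in>W. DW (Bar a # w))"
  proof
    fix v assume "v \<in> absL a (\<Union>w\<in>W. DW w)"
    then obtain w where w: "v \<in> DW (Bar a # w)" "DW w \<subseteq> (\<Union>w\<in>W. DW w)"
      by (auto simp: absL_def)
    from w(2) assms obtain w' where "w' \<in> W" "wle w w'" by (rule DW_subset_UN)
    with w(1) show "v \<in> (\<Union>w\<in>W. DW (Bar a # w))" using wle_DW[OF wle_Bar] by blast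
  qed
qed (auto simp: absL_def)

lemma absL_DW: "absL a (DW w) = DW (Bar a # w)"
  using absL_UN[of "{w}"] by simp

lemma absL_empty [simp]: "absL a {} = {}"
  using absL_UN[of "{}"] by simp

lemma good_absL: "good U \<Longrightarrow> good (absL a U)"
proof -
  assume "good U"
  then obtain W where "finite W" "U = (\<Union>w\<in>W. DW w)" by (auto simp: good_def)
  then show ?thesis unfolding good_def
    by (intro exI[of _ "(#) (Bar a) ` W"]) (auto simp: absL_UN)
qed

lemma absL_Un:
  assumes "good U" "good V"
  shows "absL a (U \<union> V) = absL a U \<union> absL a V"
proof -
  obtain W W' where "finite W" "U = (\<Union>w\<in>W. DW w)" "finite W'" "V = (\<Union>w\<in>W'. DW w)"
    using assms by (auto simp: good_def)
  then show ?thesis using absL_UN[of "W \<union> W'" a] by (simp add: UN_Un absL_UN)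
qed

lemma Cons_subset_absL:
  assumes "good U"
  shows "(#) a ` U \<subseteq> absL a U"
proof -
  obtain W where "finite W" "U = (\<Union>w\<in>W. DW w)" using assms by (auto simp: good_def)
  then show ?thesis using Cons_DW_subset by (fastforce simp: absL_UN)
qed

lemma lact_absL: "lact \<pi> (absL a U) = absL (\<pi> \<langle>$\<rangle> a) (lact \<pi> U)"
proof -
  have sub: "lact \<pi> (absL a U) \<subseteq> absL (\<pi> \<langle>$\<rangle> a) (lact \<pi> U)" for \<pi> a U
  proof
    fix v assume "v \<in> lact \<pi> (absL a U)"
    then obtain w where w: "v \<in> lact \<pi> (DW (Bar a # w))" "DW w \<subseteq> U"
      by (auto simp: absL_def)
    have "v \<in> DW (Bar (\<pi> \<langle>$\<rangle> a) # wact \<pi> w)" using w(1) by (simp add: lact_DW)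
    moreover have "DW (wact \<pi> w) \<subseteq> lact \<pi> U"
      using w(2) unfolding lact_DW[symmetric] by (rule image_mono)
    ultimately show "v \<in> absL (\<pi> \<langle>$\<rangle> a) (lact \<pi> U)" by (auto simp: absL_def)
  qed
  have "absL (\<pi> \<langle>$\<rangle> a) (lact \<pi> U) = lact \<pi> (lact (inverse \<pi>) (absL (\<pi> \<langle>$\<rangle> a) (lact \<pi> U)))"
    by (simp only: lact_times[symmetric] perm.right_inverse lact_one)
  also have "\<dots> \<subseteq> lact \<pi> (absL (inverse \<pi> \<langle>$\<rangle> (\<pi> \<langle>$\<rangle> a)) (lact (inverse \<pi>) (lact \<pi> U)))"
    by (intro image_mono sub)
  also have "\<dots> = lact \<pi> (absL a U)"
    by (simp only: lact_times[symmetric] perm.left_inverse lact_one apply_inverse_apply)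
  finally show ?thesis using sub by blast
qed

text \<open>That \<open>a\<close> is fresh for \<open>U\<close> does not make it fresh for the strings generating \<open>U\<close>, but those in
  which \<open>a\<close> occurs freely are redundant.\<close>

lemma absL_swap:
  assumes "good U" "finite A" "a \<notin> A"
    and inv: "\<And>c. c \<notin> A \<Longrightarrow> lact \<langle>a \<leftrightarrow> c\<rangle> U = U"
  shows "absL a (lact \<langle>a \<leftrightarrow> b\<rangle> U) = absL b U"
proof -
  obtain W where W: "finite W" "U = (\<Union>w\<in>W. DW w)" using assms(1) by (auto simp: good_def)
  define V where "V = {w \<in> W. a \<notin> FN w}"
  obtain c where c: "c \<notin> A \<union> (\<Union>w\<in>W. FN w)"
    by (rule fresh_name[of "A \<union> (\<Union>w\<in>W. FN w)"]) (use assms(2) W(1) in auto)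
  have UV: "U = (\<Union>w\<in>V. DW w)"
  proof
    show "U \<subseteq> (\<Union>w\<in>V. DW w)"
    proof
      fix v assume "v \<in> U"
      then obtain w where w: "w \<in> W" "v \<in> DW w" using W(2) by auto
      \<comment> \<open>Since \<open>U\<close> is invariant under swapping \<open>a\<close> and
        \<open>c\<close>, the string \<open>w\<close> lies below a swapped generator. If
        \<open>a\<close> were free in that generator before the swap, \<open>c\<close> would be free
        in it afterwards and hence in \<open>w\<close>, contrary to the choice of
        \<open>c\<close>.\<close>
      have "DW w \<subseteq> lact \<langle>a \<leftrightarrow> c\<rangle> U" using inv c w W(2) by auto
      also have "\<dots> = (\<Union>w\<in>wact \<langle>a \<leftrightarrow> c\<rangle> ` W. DW w)"
        by (simp add: W(2) image_UN lact_DW)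
      finally obtain u where "u \<in> wact \<langle>a \<leftrightarrow> c\<rangle> ` W" "wle w u"
        by (rule DW_subset_UN) (use W(1) in simp)
      then obtain w' where w': "w' \<in> W" "wle w (wact \<langle>a \<leftrightarrow> c\<rangle> w')" by auto
      have "c \<notin> FN w" "c \<notin> FN w'" using c w w' by auto
      then have "c \<notin> FN (wact \<langle>a \<leftrightarrow> c\<rangle> w')" using wle_FN[OF w'(2)] by auto
      then have a: "a \<notin> FN w'" by (force simp: FN_wact)
      have "DW (wact \<langle>a \<leftrightarrow> c\<rangle> w') = DW w'"
      proof (rule DW_aeq)
        have "db (\<lambda>x. Inr (\<langle>a \<leftrightarrow> c\<rangle> \<langle>$\<rangle> x)) 0 w' = db Inr 0 w'"
          using a \<open>c \<notin> FN w'\<close> by (intro db_cong_FN) (metis swap_other)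
        then show "aeq (wact \<langle>a \<leftrightarrow> c\<rangle> w') w'" by (simp add: aeq_def db_wact)
      qed
      then have "v \<in> DW w'" using wle_DW[OF w'(2)] w(2) by blast
      then show "v \<in> (\<Union>w\<in>V. DW w)" using a w' by (auto simp: V_def)
    qed
  qed (auto simp: W V_def)
  have V: "finite V" using W by (simp add: V_def)
  from UV have "absL a (lact \<langle>a \<leftrightarrow> b\<rangle> U) = absL a (\<Union>w\<in>wact \<langle>a \<leftrightarrow> b\<rangle> ` V. DW w)"
    by (simp add: image_UN lact_DW)
  also have "\<dots> = (\<Union>w\<in>V. DW (Bar a # wact \<langle>a \<leftrightarrow> b\<rangle> w))"
    using V by (subst absL_UN) auto
  also have "\<dots> = (\<Union>w\<in>V. DW (Bar b # w))"
    using aeq_Bar_swap DW_aeq by (intro SUP_cong) (auto simp: V_def)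
  also have "\<dots> = absL b U"
    using V UV by (simp add: absL_UN)
  finally show ?thesis .
qed

section \<open>Soundness of derivable equality\<close>

primrec sem :: "('x \<Rightarrow> name list set) \<Rightarrow> 'x trm \<Rightarrow> name list set" where
  "sem f (Var x) = f x"
| "sem f Zero = {}"
| "sem f (Plus t u) = sem f t \<union> sem f u"
| "sem f (Pre a t) = (#) a ` sem f t"
| "sem f (Abs a t) = absL a (sem f t)"

text \<open>The valuations for which soundness is shown: \<open>good\<close> values give additivity
  of \<open>absL\<close>, and equivariance makes names fresh for a variable harmless for its
  language.\<close>

definition good_map :: "'x gset \<Rightarrow> ('x \<Rightarrow> name list set) \<Rightarrow> bool" where
  "good_map X f \<longleftrightarrow> (\<forall>x\<in>carrier X. good (f x)) \<and>
     (\<forall>\<pi>. \<forall>x\<in>carrier X. f (act X \<pi> x) = lact \<pi> (f x))"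

lemma good_sem: "(\<And>x. x \<in> set_trm t \<Longrightarrow> good (f x)) \<Longrightarrow> good (sem f t)"
  by (induction t) (auto intro: good_empty good_Un good_Cons good_absL)

lemma sem_cong: "(\<And>x. x \<in> set_trm t \<Longrightarrow> f x = g x) \<Longrightarrow> sem f t = sem g t"
  by (induction t) auto

lemma sem_subst: "sem f (subst \<sigma> t) = sem (\<lambda>x. sem f (\<sigma> x)) t"
  by (induction t) auto

lemma sem_act:
  assumes "good_map X f" "set_trm t \<subseteq> carrier X"
  shows "sem f (trm_act (act X) \<pi> t) = lact \<pi> (sem f t)"
  using assms(2)
proof (induction t)
  case (Var x)
  then show ?case using assms(1) by (simp add: good_map_def)
next
  case (Pre a t)
  then show ?case by (simp add: image_image)
next
  case (Abs a t)
  then show ?case by (simp add: lact_absL)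
qed (auto simp: image_Un)

lemma fresh_iff: "fresh X a x \<longleftrightarrow> (\<exists>A. finite A \<and> supports X A x \<and> a \<notin> A)"
  by (auto simp: fresh_def supp_def)

lemma supports_swap: "supports X A x \<Longrightarrow> a \<notin> A \<Longrightarrow> c \<notin> A \<Longrightarrow> act X \<langle>a \<leftrightarrow> c\<rangle> x = x"
  unfolding supports_def by (metis swap_other)

text \<open>A set supporting \<open>x\<close> and avoiding \<open>a\<close> serves as
  \<open>A\<close> in \<open>absL_swap\<close>, because \<open>f\<close> is equivariant. Applied to
  \<open>Term m X\<close> this is the soundness of \<open>perm\<close>; applied to \<open>X\<close>
  itself it makes \<open>absL\<close> well defined on name abstractions.\<close>

lemma absL_fresh:
  assumes "good_map X f" "x \<in> carrier X" "fresh X a x"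
  shows "absL a (f (act X \<langle>a \<leftrightarrow> b\<rangle> x)) = absL b (f x)"
proof -
  obtain A where A: "finite A" "supports X A x" "a \<notin> A"
    using assms(3) by (auto simp: fresh_iff)
  have "absL a (lact \<langle>a \<leftrightarrow> b\<rangle> (f x)) = absL b (f x)"
  proof (rule absL_swap[OF _ A(1,3)])
    show "good (f x)" using assms by (simp add: good_map_def)
    show "lact \<langle>a \<leftrightarrow> c\<rangle> (f x) = f x" if "c \<notin> A" for c
    proof -
      have "lact \<langle>a \<leftrightarrow> c\<rangle> (f x) = f (act X \<langle>a \<leftrightarrow> c\<rangle> x)"
        using assms by (simp add: good_map_def)
      then show ?thesis using supports_swap[OF A(2,3) that] by simp
    qed
  qed
  then show ?thesis using assms by (simp add: good_map_def)
qed

lemma good_map_sem: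
  assumes "good_map X f"
  shows "good_map (Term m X) (sem f)"
  using assms unfolding good_map_def
  by (auto simp: Term_def intro!: good_sem sem_act[OF assms])

lemma loc_axiom_sound:
  assumes "loc_axiom Y m r s" "nominal Y" "\<And>y. y \<in> carrier Y \<Longrightarrow> good (g y)"
  shows "sem g (trm_act (act Y) \<tau> r) = sem g (trm_act (act Y) \<tau> s)"
proof -
  have "good (g (act Y \<tau> y))" if "y \<in> carrier Y" for y
    using assms(2,3) that by (simp add: nominal_def)
  with assms(1) show ?thesis
    by cases (auto simp: image_Un absL_Un dest: Cons_subset_absL)
qed

lemma deriv_sound: "deriv X n t u \<Longrightarrow> good_map X f \<Longrightarrow> sem f t = sem f u"
proof (induction rule: deriv.induct)
  case (ax Y m r s \<sigma> l \<tau>)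
  have "good (sem f (\<sigma> y))" if "y \<in> carrier Y" for y
    using good_map_sem[OF ax.prems, of l] ax.hyps(4)[OF that] by (simp add: good_map_def)
  then show ?case
    using loc_axiom_sound[OF ax.hyps(3,1)] by (simp add: sem_subst Term_def)
next
  case (perm u m t a b)
  then show ?case using absL_fresh[OF good_map_sem] by simp
qed simp_all

section \<open>Completeness over the one-element set\<close>

lemma carrier_Term_One: "carrier (Term n One) = {t. uniform_depth n t}"
  by (simp add: Term_def One_def)

lemma trm_act_one: "(\<And>x. x \<in> set_trm t \<Longrightarrow> f 1 x = x) \<Longrightarrow> trm_act f 1 t = t"
  by (induction t) auto

lemma trm_act_One_times: "trm_act (act One) (\<pi> * \<rho>) t = trm_act (act One) \<pi> (trm_act (act One) \<rho> t)"
  by (induction t) (simp_all add: One_def apply_times)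

lemma trm_act_One_one [simp]: "trm_act (act One) 1 t = t"
  by (rule trm_act_one) (simp add: One_def)

lemma uniform_depth_act: "uniform_depth n t \<Longrightarrow> uniform_depth n (trm_act f \<pi> t)"
  by (induction rule: uniform_depth.induct) (auto intro: uniform_depth.intros)

primrec trm_names :: "'x trm \<Rightarrow> name set" where
  "trm_names (Var x) = {}"
| "trm_names Zero = {}"
| "trm_names (Plus t u) = trm_names t \<union> trm_names u"
| "trm_names (Pre a t) = insert a (trm_names t)"
| "trm_names (Abs a t) = insert a (trm_names t)"

lemma finite_trm_names: "finite (trm_names t)"
  by (induction t) auto

lemma trm_act_idle: "(\<And>a. a \<in> trm_names t \<Longrightarrow> \<pi> \<langle>$\<rangle> a = a) \<Longrightarrow> trm_act (act One) \<pi> t = t"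
  by (induction t) (auto simp: One_def)

declare deriv.trans [trans]

lemma deriv_refl: "uniform_depth n t \<Longrightarrow> set_trm t \<subseteq> carrier X \<Longrightarrow> deriv X n t t"
  by (induction rule: uniform_depth.induct) (auto intro: deriv.intros)

lemma deriv_One_refl: "uniform_depth n t \<Longrightarrow> deriv One n t t"
  by (rule deriv_refl) (auto simp: One_def)

text \<open>The axioms may be instantiated by any finite set \<open>T\<close> of terms: the context is the closure of
  \<open>T\<close> under the action, and the substitution is the inclusion.\<close>

lemma deriv_One_axiom:
  fixes T :: "unit trm set"
  assumes T: "finite T" "\<And>t. t \<in> T \<Longrightarrow> uniform_depth l t"
    and ax: "\<And>Y. T \<subseteq> carrier Y \<Longrightarrow> (T = {} \<Longrightarrow> carrier Y = {}) \<Longrightarrow> loc_axiom Y m r s"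
  shows "deriv One (m + l) (subst (\<lambda>t. t) r) (subst (\<lambda>t. t) s)"
proof -
  define Y where "Y = \<lparr>carrier = {trm_act (act One) \<pi> t | \<pi> t. t \<in> T}, act = trm_act (act One)\<rparr>"
  have act: "act Y = trm_act (act One)" by (simp add: Y_def)
  have Y: "y \<in> carrier Y \<longleftrightarrow> (\<exists>\<pi>. \<exists>t\<in>T. y = trm_act (act One) \<pi> t)" for y
    by (auto simp: Y_def)
  have cl: "act Y \<pi> y \<in> carrier Y" if "y \<in> carrier Y" for \<pi> y
    using that unfolding Y act by (metis trm_act_One_times)
  have depth: "uniform_depth l y" if "y \<in> carrier Y" for y
    using that T(2) by (auto simp: Y intro: uniform_depth_act)
  have nom: "nominal Y"
    unfolding nominal_def
  proof (intro conjI allI ballI cl)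
    fix x
    have "supports Y (trm_names x) x" by (simp add: supports_def act trm_act_idle)
    then show "\<exists>A. finite A \<and> supports Y A x" using finite_trm_names by blast
  qed (simp_all add: act trm_act_One_times)
  have "orbit_of Y ` carrier Y \<subseteq> orbit_of Y ` T"
  proof
    fix C assume "C \<in> orbit_of Y ` carrier Y"
    then obtain \<pi> t where t: "t \<in> T" "C = orbit_of Y (trm_act (act One) \<pi> t)"
      by (auto simp: Y)
    have "orbit_of Y (trm_act (act One) \<pi> t) = orbit_of Y t"
    proof
      show "orbit_of Y (trm_act (act One) \<pi> t) \<subseteq> orbit_of Y t"
        by (auto simp: orbit_of_def act trm_act_One_times[symmetric])
      show "orbit_of Y t \<subseteq> orbit_of Y (trm_act (act One) \<pi> t)"
      proof
        fix y assume "y \<in> orbit_of Y t"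
        then obtain \<rho> where "y = trm_act (act One) \<rho> t" by (auto simp: orbit_of_def act)
        moreover have "\<rho> = \<rho> * inverse \<pi> * \<pi>" by (simp add: mult.assoc)
        ultimately have "y = act Y (\<rho> * inverse \<pi>) (trm_act (act One) \<pi> t)"
          unfolding act by (metis trm_act_One_times)
        then show "y \<in> orbit_of Y (trm_act (act One) \<pi> t)" by (simp add: orbit_of_def)
      qed
    qed
    with t show "C \<in> orbit_of Y ` T" by blast
  qed
  then have of: "orbit_finite Y"
    unfolding orbit_finite_def using T(1) by (meson finite_imageI finite_subset)
  have "T \<subseteq> carrier Y"
  proof
    fix t assume "t \<in> T"
    then show "t \<in> carrier Y" unfolding Y by (intro exI[of _ 1] bexI[of _ t]) simp_all
  qed
  \<comment> \<open>For empty \<open>T\<close> the context is empty, as the axioms for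
    \<open>Zero\<close> under a prefix demand.\<close>
  then have axY: "loc_axiom Y m r s" by (rule ax) (simp add: Y_def)
  have "deriv One (m + l) (subst (\<lambda>t. t) (act (Term m Y) 1 r)) (subst (\<lambda>t. t) (act (Term m Y) 1 s))"
  proof (rule deriv_ax_any[OF nom of axY])
    show "y \<in> carrier (Term l One)" if "y \<in> carrier Y" for y
      using depth[OF that] by (simp add: carrier_Term_One)
    show "deriv One l (act (Term l One) \<pi> y) (act Y \<pi> y)" if "y \<in> carrier Y" for \<pi> y
      using deriv_One_refl[OF depth[OF cl[OF that]]] by (simp add: Term_def act)
  qed
  moreover have "act (Term m Y) 1 t = t" for t
    by (simp add: Term_def trm_act_one act)
  ultimately show ?thesis by simp
qed

section \<open>Equations between terms over the one-element set\<close>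

lemma plus_zero: "uniform_depth n t \<Longrightarrow> deriv One n (Plus t Zero) t"
  using deriv_One_axiom[of "{t}" n 0 "Plus (Var t) Zero" "Var t"]
  by (simp add: loc_axiom.unit)

lemma plus_idem: "uniform_depth n t \<Longrightarrow> deriv One n (Plus t t) t"
  using deriv_One_axiom[of "{t}" n 0 "Plus (Var t) (Var t)" "Var t"]
  by (simp add: loc_axiom.idem)

lemma plus_comm: "uniform_depth n t \<Longrightarrow> uniform_depth n u \<Longrightarrow>
    deriv One n (Plus t u) (Plus u t)"
  using deriv_One_axiom[of "{t, u}" n 0 "Plus (Var t) (Var u)" "Plus (Var u) (Var t)"]
  by (auto simp: loc_axiom.comm)

lemma plus_assoc: "\<lbrakk>uniform_depth n t; uniform_depth n u; uniform_depth n v\<rbrakk> \<Longrightarrow>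
    deriv One n (Plus (Plus t u) v) (Plus t (Plus u v))"
  using deriv_One_axiom[of "{t, u, v}" n 0 "Plus (Plus (Var t) (Var u)) (Var v)"
      "Plus (Var t) (Plus (Var u) (Var v))"]
  by (auto simp: loc_axiom.assoc)

lemma pre_plus: "uniform_depth n t \<Longrightarrow> uniform_depth n u \<Longrightarrow>
    deriv One (Suc n) (Pre a (Plus t u)) (Plus (Pre a t) (Pre a u))"
  using deriv_One_axiom[of "{t, u}" n 1 "Pre a (Plus (Var t) (Var u))"
      "Plus (Pre a (Var t)) (Pre a (Var u))"]
  by (auto simp: loc_axiom.pre_plus[simplified])

lemma pre_zero: "deriv One (Suc n) (Pre a Zero) Zero"
  using deriv_One_axiom[of "{}" n 1 "Pre a Zero" Zero]
  by (auto simp: loc_axiom.pre_zero[simplified])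

lemma abs_plus: "uniform_depth n t \<Longrightarrow> uniform_depth n u \<Longrightarrow>
    deriv One (Suc n) (Abs a (Plus t u)) (Plus (Abs a t) (Abs a u))"
  using deriv_One_axiom[of "{t, u}" n 1 "Abs a (Plus (Var t) (Var u))"
      "Plus (Abs a (Var t)) (Abs a (Var u))"]
  by (auto simp: loc_axiom.abs_plus[simplified])

lemma abs_zero: "deriv One (Suc n) (Abs a Zero) Zero"
  using deriv_One_axiom[of "{}" n 1 "Abs a Zero" Zero]
  by (auto simp: loc_axiom.abs_zero[simplified])

lemma pre_plus_abs: "uniform_depth n t \<Longrightarrow> deriv One (Suc n) (Plus (Pre a t) (Abs a t)) (Abs a t)"
  using deriv_One_axiom[of "{t}" n 1 "Plus (Pre a (Var t)) (Abs a (Var t))" "Abs a (Var t)"]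
  by (auto simp: loc_axiom.pre_abs[simplified])

lemma plus_left_comm:
  assumes "uniform_depth n t" "uniform_depth n u" "uniform_depth n v"
  shows "deriv One n (Plus t (Plus u v)) (Plus u (Plus t v))"
proof -
  have "deriv One n (Plus t (Plus u v)) (Plus (Plus t u) v)"
    using assms by (rule deriv.symm[OF plus_assoc])
  also have "deriv One n (Plus (Plus t u) v) (Plus (Plus u t) v)"
    using assms by (intro deriv.cong_plus plus_comm deriv_One_refl)
  also have "deriv One n (Plus (Plus u t) v) (Plus u (Plus t v))"
    using assms by (intro plus_assoc)
  finally show ?thesis .
qed

section \<open>Bar strings as terms and normal forms\<close>

primrec bt :: "letter list \<Rightarrow> unit trm" where
  "bt [] = Var ()"
| "bt (s # w) = (case s of Fr a \<Rightarrow> Pre a (bt w) | Bar a \<Rightarrow> Abs a (bt w))"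

lemma uniform_depth_bt: "uniform_depth (length w) (bt w)"
  by (induction w) (auto intro: uniform_depth.intros split: letter.split)

lemma bt_wact: "bt (wact \<pi> w) = trm_act (act One) \<pi> (bt w)"
  by (induction w) (auto split: letter.split simp: One_def)

text \<open>An instance of \<open>perm\<close>. Terms are raw, so its freshness condition counts
  bound names as well: \<open>c\<close> must not occur in \<open>w\<close> at all, and then
  \<open>a\<close> no longer occurs after the swap.\<close>

lemma bt_swap:
  assumes "c \<notin> ub ` set w" "c \<noteq> a"
  shows "deriv One (Suc (length w)) (Abs a (bt w)) (Abs c (bt (wact \<langle>c \<leftrightarrow> a\<rangle> w)))"
proof (rule deriv.perm)
  let ?w = "wact \<langle>c \<leftrightarrow> a\<rangle> w"
  show "bt ?w \<in> carrier (Term (length w) One)"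
    using uniform_depth_bt[of ?w] by (simp add: carrier_Term_One)
  have "wact \<langle>a \<leftrightarrow> c\<rangle> ?w = w" by (simp only: swap_sym[of a c] wact_swap_swap)
  then have "act (Term (length w) One) \<langle>a \<leftrightarrow> c\<rangle> (bt ?w) = bt w"
    by (simp add: Term_def bt_wact[symmetric] del: map_map)
  then show "deriv One (length w) (bt w) (act (Term (length w) One) \<langle>a \<leftrightarrow> c\<rangle> (bt ?w))"
    by (simp add: deriv_One_refl uniform_depth_bt)
  show "fresh (Term (length w) One) a (bt ?w)"
    unfolding fresh_iff
  proof (intro exI conjI)
    show "supports (Term (length w) One) (ub ` set ?w) (bt ?w)"
      unfolding supports_def
    proof (intro allI impI)
      fix \<pi> assume "\<forall>a\<in>ub ` set ?w. \<pi> \<langle>$\<rangle> a = a"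
      then have "wact \<pi> ?w = ?w" by (intro wact_idle) blast
      then show "act (Term (length w) One) \<pi> (bt ?w) = bt ?w"
        by (simp add: Term_def bt_wact[symmetric] del: map_map)
    qed
    have ne: "\<langle>c \<leftrightarrow> a\<rangle> \<langle>$\<rangle> (ub s) \<noteq> a" if "s \<in> set w" for s
    proof
      assume "\<langle>c \<leftrightarrow> a\<rangle> \<langle>$\<rangle> (ub s) = a"
      then have "ub s = c" by (metis swap_swap apply_swap_simp(2))
      with that assms(1) show False by blast
    qed
    have "ub ` set ?w = (\<lambda>s. \<langle>c \<leftrightarrow> a\<rangle> \<langle>$\<rangle> (ub s)) ` set w"
      by (simp add: image_image ub_letter_act)
    then show "a \<notin> ub ` set ?w" using ne by (simp only: image_iff) metis
  qed simp
qed (use assms in simp)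

lemma aeq_bt: "aeq w w' \<Longrightarrow> deriv One (length w) (bt w) (bt w')"
proof (induction rule: aeq_induct)
  case Nil
  then show ?case by (simp add: deriv.refl One_def)
next
  case (Fr a w w')
  then show ?case by (simp add: deriv.cong_pre)
next
  case (Bar a b c w w')
  have len: "length w' = length w" using aeq_length[OF Bar.hyps(5)] by simp
  have "deriv One (Suc (length w)) (Abs a (bt w)) (Abs c (bt (wact \<langle>c \<leftrightarrow> a\<rangle> w)))"
    using Bar.hyps by (intro bt_swap)
  also have "deriv One (Suc (length w)) (Abs c (bt (wact \<langle>c \<leftrightarrow> a\<rangle> w))) (Abs c (bt (wact \<langle>c \<leftrightarrow> b\<rangle> w')))"
    using Bar.IH by (intro deriv.cong_abs) simp
  also have "deriv One (Suc (length w)) (Abs c (bt (wact \<langle>c \<leftrightarrow> b\<rangle> w'))) (Abs b (bt w'))"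
    using deriv.symm[OF bt_swap[of c w' b]] Bar.hyps by (simp add: len)
  finally show ?case by simp
qed

text \<open>The equational counterpart of \<open>unbar_DW\<close>: an inclusion of languages becomes
  absorption of a summand.\<close>

lemma unbar_bt: "unbar w w' \<Longrightarrow> deriv One (length w) (Plus (bt w) (bt w')) (bt w')"
proof (induction w arbitrary: w')
  case Nil
  then show ?case by (auto intro: plus_idem uniform_depth.intros)
next
  case (Cons s w)
  let ?n = "length w"
  obtain s' v where w': "w' = s' # v" and v: "unbar w v"
    using Cons.prems by (cases s) (auto simp: unbar_Fr unbar_Bar)
  have "?n = length v" using v by (simp add: unbar_def list_all2_lengthD)
  then have ud: "uniform_depth ?n (bt w)" "uniform_depth ?n (bt v)"
    using uniform_depth_bt by metis+
  note IH = Cons.IH[OF v]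
  have pre: "deriv One (Suc ?n) (Plus (Pre a (bt w)) (Pre a (bt v))) (Pre a (bt v))" for a
    using deriv.symm[OF pre_plus[OF ud]] deriv.cong_pre[OF IH] by (rule deriv.trans)
  have abs: "deriv One (Suc ?n) (Plus (Abs a (bt w)) (Abs a (bt v))) (Abs a (bt v))" for a
    using deriv.symm[OF abs_plus[OF ud]] deriv.cong_abs[OF IH] by (rule deriv.trans)
  have "deriv One (Suc ?n) (Plus (Pre a (bt w)) (Abs a (bt v))) (Abs a (bt v))" for a
  proof -
    let ?p = "Pre a (bt w)" and ?q = "Pre a (bt v)" and ?r = "Abs a (bt v)"
    have ud': "uniform_depth (Suc ?n) ?p" "uniform_depth (Suc ?n) ?q" "uniform_depth (Suc ?n) ?r"
      using ud by (auto intro: uniform_depth.intros)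
    have absorb: "deriv One (Suc ?n) (Plus ?q ?r) ?r" using ud(2) by (rule pre_plus_abs)
    \<comment> \<open>The letter loses its bar here. The summand \<open>?q\<close> mediates:
      \<open>?r\<close> absorbs it by the axiom linking \<open>Pre\<close> and \<open>Abs\<close>,
      and it absorbs \<open>?p\<close> by the induction hypothesis.\<close>
    have "deriv One (Suc ?n) (Plus ?p ?r) (Plus ?p (Plus ?q ?r))"
      using ud' absorb by (intro deriv.cong_plus deriv_One_refl deriv.symm[OF absorb])
    also have "deriv One (Suc ?n) (Plus ?p (Plus ?q ?r)) (Plus (Plus ?p ?q) ?r)"
      using ud' by (intro deriv.symm[OF plus_assoc])
    also have "deriv One (Suc ?n) (Plus (Plus ?p ?q) ?r) (Plus ?q ?r)"
      using ud' by (intro deriv.cong_plus deriv_One_refl pre)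
    also note absorb
    finally show ?thesis .
  qed
  with pre abs show ?case
    using Cons.prems w' by (cases s) (auto simp: unbar_Fr unbar_Bar)
qed

lemma wle_length: "wle w w' \<Longrightarrow> length w = length w'"
  unfolding wle_def unbar_def by (auto dest!: aeq_length list_all2_lengthD)

lemma wle_bt:
  assumes "wle w w'"
  shows "deriv One (length w) (Plus (bt w) (bt w')) (bt w')"
proof -
  obtain v v' where v: "aeq w v" "unbar v v'" "aeq v' w'" using assms by (auto simp: wle_def)
  have len: "length v = length w" "length v' = length w"
    using aeq_length[OF v(1)] aeq_length[OF v(3)] wle_length[OF assms] by simp_all
  have *: "deriv One (length w) (bt w) (bt v)" "deriv One (length w) (bt v') (bt w')"
    using aeq_bt[OF v(1)] aeq_bt[OF v(3)] len by simp_all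
  have "deriv One (length w) (Plus (bt w) (bt w')) (Plus (bt v) (bt v'))"
    using * by (intro deriv.cong_plus deriv.symm[OF *(2)])
  also have "deriv One (length w) (Plus (bt v) (bt v')) (bt v')"
    using unbar_bt[OF v(2)] len by simp
  also note *(2)
  finally show ?thesis .
qed

text \<open>In contrast to \<open>sum_trm\<close>, the sum ends in \<open>Zero\<close> for nonempty
  lists too, so that plain list induction applies.\<close>

definition sumb :: "letter list list \<Rightarrow> unit trm" where
  "sumb ws = foldr (\<lambda>w t. Plus (bt w) t) ws Zero"

lemma sumb_simps [simp]: "sumb [] = Zero" "sumb (w # ws) = Plus (bt w) (sumb ws)"
  by (simp_all add: sumb_def)

lemma uniform_depth_sumb:
  "(\<And>w. w \<in> set ws \<Longrightarrow> length w = n) \<Longrightarrow> uniform_depth n (sumb ws)"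
proof (induction ws)
  case (Cons w ws)
  then show ?case using uniform_depth_bt[of w] by (auto intro: uniform_depth.intros)
qed (simp add: uniform_depth.intros)

lemma sumb_append:
  assumes "\<And>w. w \<in> set ws \<union> set vs \<Longrightarrow> length w = n"
  shows "deriv One n (Plus (sumb ws) (sumb vs)) (sumb (ws @ vs))"
  using assms
proof (induction ws)
  case Nil
  then have ud: "uniform_depth n (sumb vs)" by (intro uniform_depth_sumb) auto
  then have "deriv One n (Plus Zero (sumb vs)) (Plus (sumb vs) Zero)"
    by (intro plus_comm uniform_depth.intros)
  also have "deriv One n (Plus (sumb vs) Zero) (sumb vs)" using ud by (rule plus_zero)
  finally show ?case by simp
next
  case (Cons w ws)
  have ud: "uniform_depth n (bt w)" "uniform_depth n (sumb ws)" "uniform_depth n (sumb vs)"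
    using uniform_depth_bt[of w] Cons.prems by (auto intro!: uniform_depth_sumb)
  then have "deriv One n (Plus (Plus (bt w) (sumb ws)) (sumb vs)) (Plus (bt w) (Plus (sumb ws) (sumb vs)))"
    by (intro plus_assoc)
  also have "deriv One n (Plus (bt w) (Plus (sumb ws) (sumb vs))) (Plus (bt w) (sumb (ws @ vs)))"
    using ud Cons by (intro deriv.cong_plus deriv_One_refl) auto
  finally show ?case by simp
qed

lemma pre_sumb:
  assumes "\<And>w. w \<in> set ws \<Longrightarrow> length w = n"
  shows "deriv One (Suc n) (Pre a (sumb ws)) (sumb (map ((#) (Fr a)) ws))"
  using assms
proof (induction ws)
  case Nil
  then show ?case by (simp add: pre_zero)
next
  case (Cons w ws)
  have ud: "uniform_depth n (bt w)" "uniform_depth n (sumb ws)"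
    using uniform_depth_bt[of w] Cons.prems by (auto intro!: uniform_depth_sumb)
  then have "deriv One (Suc n) (Pre a (Plus (bt w) (sumb ws))) (Plus (Pre a (bt w)) (Pre a (sumb ws)))"
    by (rule pre_plus)
  also have "deriv One (Suc n) (Plus (Pre a (bt w)) (Pre a (sumb ws)))
      (Plus (Pre a (bt w)) (sumb (map ((#) (Fr a)) ws)))"
    using ud Cons by (intro deriv.cong_plus deriv_One_refl uniform_depth.intros) auto
  finally show ?case by simp
qed

lemma abs_sumb:
  assumes "\<And>w. w \<in> set ws \<Longrightarrow> length w = n"
  shows "deriv One (Suc n) (Abs a (sumb ws)) (sumb (map ((#) (Bar a)) ws))"
  using assms
proof (induction ws)
  case Nil
  then show ?case by (simp add: abs_zero)
next
  case (Cons w ws)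
  have ud: "uniform_depth n (bt w)" "uniform_depth n (sumb ws)"
    using uniform_depth_bt[of w] Cons.prems by (auto intro!: uniform_depth_sumb)
  then have "deriv One (Suc n) (Abs a (Plus (bt w) (sumb ws))) (Plus (Abs a (bt w)) (Abs a (sumb ws)))"
    by (rule abs_plus)
  also have "deriv One (Suc n) (Plus (Abs a (bt w)) (Abs a (sumb ws)))
      (Plus (Abs a (bt w)) (sumb (map ((#) (Bar a)) ws)))"
    using ud Cons by (intro deriv.cong_plus deriv_One_refl uniform_depth.intros) auto
  finally show ?case by simp
qed

lemma normal_form:
  "uniform_depth n t \<Longrightarrow> \<exists>ws. (\<forall>w\<in>set ws. length w = n) \<and> deriv One n t (sumb ws)"
proof (induction rule: uniform_depth.induct)
  case (1 x)
  have "deriv One 0 (Var x) (Plus (Var x) Zero)"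
    by (intro deriv.symm[OF plus_zero] uniform_depth.intros)
  then show ?case by (intro exI[of _ "[[]]"]) simp
next
  case (2 n)
  show ?case by (intro exI[of _ "[]"]) (simp add: deriv.cong_zero)
next
  case (3 n t u)
  then obtain ws vs where *: "\<forall>w\<in>set ws. length w = n" "deriv One n t (sumb ws)"
    "\<forall>w\<in>set vs. length w = n" "deriv One n u (sumb vs)" by blast
  have "deriv One n (Plus t u) (Plus (sumb ws) (sumb vs))"
    using * by (intro deriv.cong_plus)
  also have "deriv One n (Plus (sumb ws) (sumb vs)) (sumb (ws @ vs))"
    using * by (intro sumb_append) auto
  finally show ?case using * by (intro exI[of _ "ws @ vs"]) auto
next
  case (4 n t a)
  then obtain ws where *: "\<forall>w\<in>set ws. length w = n" "deriv One n t (sumb ws)" by blast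
  have "deriv One (Suc n) (Pre a t) (sumb (map ((#) (Fr a)) ws))"
    using deriv.cong_pre[OF *(2)] pre_sumb[of ws n a] * by (blast intro: deriv.trans)
  then show ?case using * by (intro exI[of _ "map ((#) (Fr a)) ws"]) auto
next
  case (5 n t a)
  then obtain ws where *: "\<forall>w\<in>set ws. length w = n" "deriv One n t (sumb ws)" by blast
  have "deriv One (Suc n) (Abs a t) (sumb (map ((#) (Bar a)) ws))"
    using deriv.cong_abs[OF *(2)] abs_sumb[of ws n a] * by (blast intro: deriv.trans)
  then show ?case using * by (intro exI[of _ "map ((#) (Bar a)) ws"]) auto
qed

lemma sumb_absorb_one:
  assumes "wle w w'" "w' \<in> set ws" "\<And>v. v \<in> set ws \<Longrightarrow> length v = n"
  shows "deriv One n (Plus (bt w) (sumb ws)) (sumb ws)"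
  using assms(2,3)
proof (induction ws)
  case (Cons v ws)
  have lw: "length w = n" using wle_length[OF assms(1)] Cons.prems by simp
  then have ud: "uniform_depth n (bt w)" "uniform_depth n (bt v)" "uniform_depth n (sumb ws)"
    using uniform_depth_bt[of w] uniform_depth_bt[of v] Cons.prems(2)
    by (auto intro!: uniform_depth_sumb)
  show ?case
  proof (cases "v = w'")
    case True
    have "deriv One n (Plus (bt w) (Plus (bt v) (sumb ws))) (Plus (Plus (bt w) (bt v)) (sumb ws))"
      using ud by (intro deriv.symm[OF plus_assoc])
    also have "deriv One n (Plus (Plus (bt w) (bt v)) (sumb ws)) (Plus (bt v) (sumb ws))"
      using ud wle_bt[OF assms(1)] True lw by (intro deriv.cong_plus deriv_One_refl) auto
    finally show ?thesis by simp
  next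
    case False
    have "deriv One n (Plus (bt w) (Plus (bt v) (sumb ws))) (Plus (bt v) (Plus (bt w) (sumb ws)))"
      using ud by (rule plus_left_comm)
    also have "deriv One n (Plus (bt v) (Plus (bt w) (sumb ws))) (Plus (bt v) (sumb ws))"
      using ud Cons False by (intro deriv.cong_plus deriv_One_refl) auto
    finally show ?thesis by simp
  qed
qed simp

lemma sumb_absorb:
  assumes "\<And>w. w \<in> set vs \<Longrightarrow> \<exists>w'\<in>set ws. wle w w'" "\<And>w. w \<in> set ws \<Longrightarrow> length w = n"
  shows "deriv One n (Plus (sumb vs) (sumb ws)) (sumb ws)"
  using assms(1)
proof (induction vs)
  case Nil
  then show ?case using sumb_append[of "[]" ws n] assms(2) by simp
next
  case (Cons w vs)
  have lv: "length v = n" if "v \<in> set (w # vs)" for v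
    using Cons.prems[OF that] wle_length assms(2) by metis
  have ud: "uniform_depth n (bt w)" "uniform_depth n (sumb vs)" "uniform_depth n (sumb ws)"
    using uniform_depth_bt[of w] lv assms(2) by (auto intro!: uniform_depth_sumb)
  then have "deriv One n (Plus (Plus (bt w) (sumb vs)) (sumb ws)) (Plus (bt w) (Plus (sumb vs) (sumb ws)))"
    by (rule plus_assoc)
  also have "deriv One n (Plus (bt w) (Plus (sumb vs) (sumb ws))) (Plus (bt w) (sumb ws))"
    using ud Cons by (intro deriv.cong_plus deriv_One_refl) auto
  also have "deriv One n (Plus (bt w) (sumb ws)) (sumb ws)"
    using Cons.prems assms(2) sumb_absorb_one by (meson list.set_intros(1))
  finally show ?case by simp
qed

section \<open>Completeness for terms over the one-element set\<close>

abbreviation sem1 :: "unit trm \<Rightarrow> name list set" where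
  "sem1 \<equiv> sem (\<lambda>_. {[]})"

lemma good_map_One: "good_map One (\<lambda>_. {[]})"
  using good_DW[of "[]"] by (simp add: good_map_def)

lemma sem1_bt: "sem1 (bt w) = DW w"
proof (induction w)
  case (Cons s w)
  then show ?case by (cases s) (simp_all add: DW_Fr absL_DW)
qed simp

lemma sem1_sumb: "sem1 (sumb ws) = (\<Union>w\<in>set ws. DW w)"
  by (induction ws) (simp_all add: sem1_bt)

text \<open>Each inclusion between the languages of the two normal forms makes one sum absorb the
  other; commutativity joins the two absorptions.\<close>

lemma deriv_One_complete:
  assumes "uniform_depth n t" "uniform_depth n u" "sem1 t = sem1 u"
  shows "deriv One n t u"
proof -
  obtain ws where ws: "\<forall>w\<in>set ws. length w = n" "deriv One n t (sumb ws)"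
    using normal_form[OF assms(1)] by blast
  obtain vs where vs: "\<forall>w\<in>set vs. length w = n" "deriv One n u (sumb vs)"
    using normal_form[OF assms(2)] by blast
  have eq: "(\<Union>w\<in>set ws. DW w) = (\<Union>w\<in>set vs. DW w)"
    using deriv_sound[OF ws(2) good_map_One] deriv_sound[OF vs(2) good_map_One] assms(3)
    by (simp add: sem1_sumb)
  have absorb: "deriv One n (Plus (sumb xs) (sumb ys)) (sumb ys)"
    if "(\<Union>w\<in>set xs. DW w) \<subseteq> (\<Union>w\<in>set ys. DW w)" "\<forall>w\<in>set ys. length w = n" for xs ys
  proof (rule sumb_absorb)
    fix w assume "w \<in> set xs"
    with that(1) have "DW w \<subseteq> (\<Union>w\<in>set ys. DW w)" by blast
    then show "\<exists>w'\<in>set ys. wle w w'" by (rule DW_subset_UN) auto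
  qed (use that(2) in simp)
  have ud: "uniform_depth n (sumb ws)" "uniform_depth n (sumb vs)"
    using ws vs by (auto intro!: uniform_depth_sumb)
  note ws(2)
  also have "deriv One n (sumb ws) (Plus (sumb vs) (sumb ws))"
    using eq ws by (intro deriv.symm[OF absorb]) auto
  also have "deriv One n (Plus (sumb vs) (sumb ws)) (Plus (sumb ws) (sumb vs))"
    using ud by (intro plus_comm)
  also have "deriv One n (Plus (sumb ws) (sumb vs)) (sumb vs)"
    using eq vs by (intro absorb) auto
  also have "deriv One n (sumb vs) u" using vs(2) by (rule deriv.symm)
  finally show ?thesis .
qed

section \<open>Name abstraction\<close>

context
  fixes Z :: "'z gset"
  assumes nom: "nominal Z"
begin

lemma act_closed: "z \<in> carrier Z \<Longrightarrow> act Z \<pi> z \<in> carrier Z"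
  and act_one: "z \<in> carrier Z \<Longrightarrow> act Z 1 z = z"
  and act_times: "z \<in> carrier Z \<Longrightarrow> act Z (\<pi> * \<rho>) z = act Z \<pi> (act Z \<rho> z)"
  and ex_supports: "z \<in> carrier Z \<Longrightarrow> \<exists>A. finite A \<and> supports Z A z"
  using nom by (simp_all add: nominal_def)

lemma ex_fresh:
  assumes "finite A" "finite S" "S \<subseteq> carrier Z"
  obtains c where "c \<notin> A" "\<And>z. z \<in> S \<Longrightarrow> fresh Z c z"
proof -
  obtain B where B: "\<And>z. z \<in> S \<Longrightarrow> finite (B z) \<and> supports Z (B z) z"
    using ex_supports assms(3) by (metis subsetD)
  obtain c where "c \<notin> A \<union> (\<Union>z\<in>S. B z)"
    by (rule fresh_name[of "A \<union> (\<Union>z\<in>S. B z)"]) (use assms B in auto)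
  then show thesis using B by (intro that) (auto simp: fresh_iff)
qed

text \<open>The two names may be fresh by virtue of different supporting sets. A third name
  \<open>e\<close> outside both sets can be swapped with either one, and conjugation yields the swap
  of \<open>c\<close> and \<open>d\<close>.\<close>

lemma fresh_swap:
  assumes "z \<in> carrier Z" "fresh Z c z" "fresh Z d z"
  shows "act Z \<langle>c \<leftrightarrow> d\<rangle> z = z"
proof (cases "c = d")
  case True
  then show ?thesis using assms(1) by (simp add: act_one)
next
  case False
  obtain A B where A: "finite A" "supports Z A z" "c \<notin> A" and B: "finite B" "supports Z B z" "d \<notin> B"
    using assms by (auto simp: fresh_iff)
  obtain e where e: "e \<notin> A \<union> B \<union> {c, d}"
    by (rule fresh_name[of "A \<union> B \<union> {c, d}"]) (use A B in auto)
  have ce: "act Z \<langle>c \<leftrightarrow> e\<rangle> z = z" using supports_swap[OF A(2,3)] e by simp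
  have de: "act Z \<langle>d \<leftrightarrow> e\<rangle> z = z" using supports_swap[OF B(2,3)] e by simp
  have "\<langle>c \<leftrightarrow> e\<rangle> * \<langle>d \<leftrightarrow> e\<rangle> = \<langle>d \<leftrightarrow> c\<rangle> * \<langle>c \<leftrightarrow> e\<rangle>"
    using swap_conj[of "\<langle>c \<leftrightarrow> e\<rangle>" d e] swap_other[of d c e] False e by auto
  then have "act Z \<langle>c \<leftrightarrow> e\<rangle> (act Z \<langle>d \<leftrightarrow> e\<rangle> z) = act Z \<langle>d \<leftrightarrow> c\<rangle> (act Z \<langle>c \<leftrightarrow> e\<rangle> z)"
    using act_times[OF assms(1)] by metis
  then show ?thesis by (simp add: ce de swap_sym[of c d])
qed

lemma fresh_act:
  assumes "z \<in> carrier Z" "fresh Z c z"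
  shows "fresh Z (\<pi> \<langle>$\<rangle> c) (act Z \<pi> z)"
proof -
  obtain A where A: "finite A" "supports Z A z" "c \<notin> A" using assms by (auto simp: fresh_iff)
  have "supports Z ((\<lambda>a. \<pi> \<langle>$\<rangle> a) ` A) (act Z \<pi> z)"
    unfolding supports_def
  proof (intro allI impI)
    fix \<rho> assume \<rho>: "\<forall>a\<in>(\<lambda>a. \<pi> \<langle>$\<rangle> a) ` A. \<rho> \<langle>$\<rangle> a = a"
    have "(inverse \<pi> * (\<rho> * \<pi>)) \<langle>$\<rangle> a = a" if "a \<in> A" for a
      using \<rho> that by (simp add: apply_times apply_inverse_apply)
    then have "act Z (inverse \<pi> * (\<rho> * \<pi>)) z = z" using A(2) by (simp add: supports_def)
    then have "act Z \<pi> z = act Z (\<pi> * (inverse \<pi> * (\<rho> * \<pi>))) z"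
      using act_times[OF assms(1)] by metis
    also have "\<pi> * (inverse \<pi> * (\<rho> * \<pi>)) = \<rho> * \<pi>"
      by (simp only: mult.assoc[symmetric] perm.right_inverse mult_1_left)
    finally show "act Z \<rho> (act Z \<pi> z) = act Z \<pi> z" using act_times[OF assms(1)] by metis
  qed
  then show ?thesis unfolding fresh_iff using A
    by (intro exI[of _ "(\<lambda>a. \<pi> \<langle>$\<rangle> a) ` A"]) (auto simp: apply_inj)
qed

text \<open>The some/any principle for name abstraction. Transitivity rests on it, since two related
  pairs come with different fresh names.\<close>

lemma abs_rel_any:
  assumes "((a, z), (b, z')) \<in> abs_rel Z" "d \<noteq> a" "d \<noteq> b" "fresh Z d z" "fresh Z d z'"
  shows "act Z \<langle>d \<leftrightarrow> a\<rangle> z = act Z \<langle>d \<leftrightarrow> b\<rangle> z'"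
proof -
  obtain c where zz: "z \<in> carrier Z" "z' \<in> carrier Z" and c: "c \<noteq> a" "c \<noteq> b" "fresh Z c z" "fresh Z c z'"
    and eq: "act Z \<langle>c \<leftrightarrow> a\<rangle> z = act Z \<langle>c \<leftrightarrow> b\<rangle> z'"
    using assms(1) by (auto simp: abs_rel_def)
  have move: "act Z \<langle>d \<leftrightarrow> x\<rangle> y = act Z \<langle>d \<leftrightarrow> c\<rangle> (act Z \<langle>c \<leftrightarrow> x\<rangle> y)"
    if "y \<in> carrier Z" "fresh Z c y" "fresh Z d y" "c \<noteq> x" "d \<noteq> x" for x y
  proof -
    have "\<langle>d \<leftrightarrow> c\<rangle> * \<langle>c \<leftrightarrow> x\<rangle> = \<langle>d \<leftrightarrow> x\<rangle> * \<langle>d \<leftrightarrow> c\<rangle>"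
      using swap_conj[of "\<langle>d \<leftrightarrow> c\<rangle>" c x] swap_other[of x d c] that by auto
    then have "act Z \<langle>d \<leftrightarrow> c\<rangle> (act Z \<langle>c \<leftrightarrow> x\<rangle> y) = act Z \<langle>d \<leftrightarrow> x\<rangle> (act Z \<langle>d \<leftrightarrow> c\<rangle> y)"
      using act_times[OF that(1)] by metis
    then show ?thesis using fresh_swap[OF that(1,3,2)] by simp
  qed
  show ?thesis using move[OF zz(1) c(3) assms(4) c(1) assms(2)] move[OF zz(2) c(4) assms(5) c(2) assms(3)] eq
    by simp
qed

lemma abs_rel_refl: "z \<in> carrier Z \<Longrightarrow> ((a, z), (a, z)) \<in> abs_rel Z"
proof -
  assume z: "z \<in> carrier Z"
  obtain c where "c \<notin> {a}" "\<And>y. y \<in> {z} \<Longrightarrow> fresh Z c y"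
    using z by (auto intro: ex_fresh[of "{a}" "{z}"])
  with z show ?thesis by (auto simp: abs_rel_def)
qed

lemma abs_rel_sym: "(p, q) \<in> abs_rel Z \<Longrightarrow> (q, p) \<in> abs_rel Z"
  unfolding abs_rel_def by (clarsimp, metis)

lemma abs_rel_trans:
  assumes "(p, q) \<in> abs_rel Z" "(q, r) \<in> abs_rel Z"
  shows "(p, r) \<in> abs_rel Z"
proof -
  obtain a x b y e z where p: "p = (a, x)" "q = (b, y)" "r = (e, z)" by (cases p, cases q, cases r)
  have cs: "x \<in> carrier Z" "y \<in> carrier Z" "z \<in> carrier Z" using assms p by (auto simp: abs_rel_def)
  obtain d where d: "d \<notin> {a, b, e}" "\<And>u. u \<in> {x, y, z} \<Longrightarrow> fresh Z d u"
    by (rule ex_fresh[of "{a, b, e}" "{x, y, z}"]) (use cs in auto)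
  have "act Z \<langle>d \<leftrightarrow> a\<rangle> x = act Z \<langle>d \<leftrightarrow> b\<rangle> y"
    using assms(1) d unfolding p by (intro abs_rel_any) auto
  also have "\<dots> = act Z \<langle>d \<leftrightarrow> e\<rangle> z"
    using assms(2) d unfolding p by (intro abs_rel_any) auto
  finally show ?thesis using cs d unfolding p abs_rel_def by auto
qed

lemma abs_class_eq_iff:
  assumes "z' \<in> carrier Z"
  shows "abs_class Z a z = abs_class Z b z' \<longleftrightarrow> ((a, z), (b, z')) \<in> abs_rel Z"
  unfolding abs_class_def
  using abs_rel_refl[OF assms, of b] abs_rel_sym abs_rel_trans by blast

lemma abs_rel_act:
  assumes "((a, z), (b, z')) \<in> abs_rel Z"
  shows "((\<pi> \<langle>$\<rangle> a, act Z \<pi> z), (\<pi> \<langle>$\<rangle> b, act Z \<pi> z')) \<in> abs_rel Z"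
proof -
  obtain c where zz: "z \<in> carrier Z" "z' \<in> carrier Z" and c: "c \<noteq> a" "c \<noteq> b" "fresh Z c z" "fresh Z c z'"
    and eq: "act Z \<langle>c \<leftrightarrow> a\<rangle> z = act Z \<langle>c \<leftrightarrow> b\<rangle> z'"
    using assms(1) by (auto simp: abs_rel_def)
  have "act Z \<langle>\<pi> \<langle>$\<rangle> c \<leftrightarrow> \<pi> \<langle>$\<rangle> x\<rangle> (act Z \<pi> y) = act Z \<pi> (act Z \<langle>c \<leftrightarrow> x\<rangle> y)" if "y \<in> carrier Z" for x y
    using swap_conj[of \<pi> c x] act_times[OF that] by metis
  then show ?thesis
    using zz c eq unfolding abs_rel_def
    by (auto simp: act_closed fresh_act apply_inj intro!: exI[of _ "\<pi> \<langle>$\<rangle> c"])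
qed

lemma abs_class_act:
  assumes "z \<in> carrier Z"
  shows "act (Abstr Z) \<pi> (abs_class Z a z) = abs_class Z (\<pi> \<langle>$\<rangle> a) (act Z \<pi> z)"
proof -
  let ?f = "\<lambda>\<pi> (a, z). (\<pi> \<langle>$\<rangle> a, act Z \<pi> z)"
  have f: "act (Abstr Z) \<pi> C = ?f \<pi> ` C" for C
    by (simp add: Abstr_def Quot_def Prod_def Names_def)
  have sub: "?f \<pi> p \<in> abs_class Z (\<pi> \<langle>$\<rangle> a) (act Z \<pi> z)" if "p \<in> abs_class Z a z" for p \<pi> a z
    using that abs_rel_act by (cases p) (auto simp: abs_class_def)
  show ?thesis unfolding f
  proof
    show "?f \<pi> ` abs_class Z a z \<subseteq> abs_class Z (\<pi> \<langle>$\<rangle> a) (act Z \<pi> z)" using sub by blast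
    show "abs_class Z (\<pi> \<langle>$\<rangle> a) (act Z \<pi> z) \<subseteq> ?f \<pi> ` abs_class Z a z"
    proof
      fix p assume p: "p \<in> abs_class Z (\<pi> \<langle>$\<rangle> a) (act Z \<pi> z)"
      then have car: "snd p \<in> carrier Z" by (auto simp: abs_class_def abs_rel_def)
      have inv: "act Z (inverse \<rho>) (act Z \<rho> y) = y" "act Z \<rho> (act Z (inverse \<rho>) y) = y"
        if "y \<in> carrier Z" for \<rho> y
        using act_times[OF that, of "inverse \<rho>" \<rho>] act_times[OF that, of \<rho> "inverse \<rho>"] act_one[OF that]
        by simp_all
      have "?f (inverse \<pi>) p \<in> abs_class Z a z"
        using sub[OF p, of "inverse \<pi>"] inv(1)[OF assms] by (simp add: apply_inverse_apply)
      moreover have "p = ?f \<pi> (?f (inverse \<pi>) p)"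
        using inv(2)[OF car] by (cases p) (simp add: apply_inverse_apply)
      ultimately show "p \<in> ?f \<pi> ` abs_class Z a z" by (rule rev_image_eqI)
    qed
  qed
qed

end

text \<open>With \<open>c\<close> the fresh name witnessing the relation, both sides equal
  \<open>absL c\<close> of the language of the common renamed element.\<close>

lemma abs_rel_absL:
  assumes "good_map X f" "((a, x), (b, y)) \<in> abs_rel X"
  shows "absL a (f x) = absL b (f y)"
proof -
  obtain c where c: "x \<in> carrier X" "y \<in> carrier X" "fresh X c x" "fresh X c y"
    and eq: "act X \<langle>c \<leftrightarrow> a\<rangle> x = act X \<langle>c \<leftrightarrow> b\<rangle> y"
    using assms(2) by (auto simp: abs_rel_def)
  show ?thesis
    using absL_fresh[OF assms(1) c(1,3), of a] absL_fresh[OF assms(1) c(2,4), of b] eq by simp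
qed

section \<open>Alpha-equivalence classes\<close>

lemma nominal_One: "nominal One"
  by (auto simp: nominal_def One_def supports_def)

lemma Prod_BarStrings_simps [simp]:
  "carrier (Prod BarStrings X) = UNIV \<times> carrier X"
  "act (Prod BarStrings X) \<pi> (w, x) = (wact \<pi> w, act X \<pi> x)"
  by (simp_all add: Prod_def BarStrings_def)

lemma supports_Prod_BarStrings:
  "supports X A x \<Longrightarrow> ub ` set w \<subseteq> B \<Longrightarrow> supports (Prod BarStrings X) (A \<union> B) (w, x)"
  using wact_idle[of w] unfolding supports_def Prod_BarStrings_simps by blast

lemma nominal_Prod_BarStrings:
  assumes "nominal X"
  shows "nominal (Prod BarStrings X)"
  unfolding nominal_def
proof (intro conjI allI ballI; clarsimp simp del: map_map)
  fix w x \<pi> \<rho>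
  assume x: "x \<in> carrier X"
  show "act X \<pi> x \<in> carrier X" "act X 1 x = x"
    using act_closed[OF assms x] act_one[OF assms x] by simp_all
  show "wact (\<pi> * \<rho>) w = wact \<pi> (wact \<rho> w) \<and> act X (\<pi> * \<rho>) x = act X \<pi> (act X \<rho> x)"
    using wact_times act_times[OF assms x] by blast
  obtain A where "finite A" "supports X A x" using ex_supports[OF assms x] by blast
  then show "\<exists>A. finite A \<and> supports (Prod BarStrings X) A (w, x)"
    using supports_Prod_BarStrings[of X A x w "ub ` set w"] by (intro exI[of _ "A \<union> ub ` set w"]) simp
qed

lemma fresh_Prod_Nil: "fresh (Prod BarStrings X) c ([], x) \<longleftrightarrow> fresh X c x"
  by (simp add: fresh_iff supports_def)

lemma fresh_Prod_FN:
  assumes "fresh (Prod BarStrings X) c (w, x)"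
  shows "c \<notin> FN w"
proof
  assume c: "c \<in> FN w"
  obtain A where A: "finite A" "supports (Prod BarStrings X) A (w, x)" "c \<notin> A"
    using assms by (auto simp: fresh_iff)
  obtain d where d: "d \<notin> A \<union> FN w"
    by (rule fresh_name[of "A \<union> FN w"]) (use A in auto)
  have "wact \<langle>c \<leftrightarrow> d\<rangle> w = w" using supports_swap[OF A(2,3)] d by simp
  moreover have "d \<in> FN (wact \<langle>c \<leftrightarrow> d\<rangle> w)" using c unfolding FN_wact by (intro image_eqI[of _ _ c]) simp_all
  ultimately show False using d by simp
qed

lemma abs_rel_Prod_Nil:
  "((a, ([], x)), (b, ([], y))) \<in> abs_rel (Prod BarStrings X) \<longleftrightarrow> ((a, x), (b, y)) \<in> abs_rel X"
  by (auto simp: abs_rel_def fresh_Prod_Nil)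

lemma alpha_step_aeq:
  assumes "alpha_step One p q"
  shows "aeq (fst p) (fst q)"
  using assms
proof cases
  case (1 x y a v b u w)
  have "((a, (v, x)), (b, (u, y))) \<in> abs_rel (Prod BarStrings One)"
    using 1 abs_class_eq_iff[OF nominal_Prod_BarStrings[OF nominal_One]] by simp
  then obtain c where c: "fresh (Prod BarStrings One) c (v, x)" "fresh (Prod BarStrings One) c (u, y)"
    and eq: "wact \<langle>c \<leftrightarrow> a\<rangle> v = wact \<langle>c \<leftrightarrow> b\<rangle> u"
    by (auto simp: abs_rel_def)
  have "aeq (Bar a # v) (Bar c # wact \<langle>c \<leftrightarrow> a\<rangle> v)"
    by (intro aeq_sym[OF aeq_Bar_swap] fresh_Prod_FN[OF c(1)])
  also have "aeq (Bar c # wact \<langle>c \<leftrightarrow> a\<rangle> v) (Bar b # u)"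
    unfolding eq by (intro aeq_Bar_swap fresh_Prod_FN[OF c(2)])
  finally (aeq_trans) show ?thesis using 1 by (simp add: aeq_append)
qed

lemma alpha_step_Cons:
  assumes "alpha_step X (w, x) (w', y)"
  shows "alpha_step X (s # w, x) (s # w', y)"
  using assms
proof cases
  case (1 a v b u w\<^sub>0)
  then show ?thesis using alpha_step.intros[of x X y a v b u "s # w\<^sub>0"] by simp
qed

lemma equivclp_alpha_step_Cons:
  assumes "equivclp (alpha_step X) p q"
  shows "equivclp (alpha_step X) (s # fst p, snd p) (s # fst q, snd q)"
  using assms
proof (induction rule: equivclp_induct)
  case (step y z)
  then have "alpha_step X (s # fst y, snd y) (s # fst z, snd z) \<or>
      alpha_step X (s # fst z, snd z) (s # fst y, snd y)"
    using alpha_step_Cons by (metis prod.collapse)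
  then show ?case using step.IH by (metis equivclp_into_equivclp)
qed simp

lemma alpha_step_swap:
  assumes "c \<notin> ub ` set w"  "c \<noteq> a"
  shows "alpha_step One (Bar a # w, ()) (Bar c # wact \<langle>c \<leftrightarrow> a\<rangle> w, ())"
proof -
  note nom = nominal_Prod_BarStrings[OF nominal_One]
  \<comment> \<open>\<open>abs_rel\<close> asks for a witness different from both bound names, so
    \<open>c\<close> itself cannot serve.\<close>
  obtain d where d: "d \<notin> ub ` set w \<union> {a, c}"
    by (rule fresh_name[of "ub ` set w \<union> {a, c}"]) auto
  let ?w = "wact \<langle>c \<leftrightarrow> a\<rangle> w"
  have fresh: "fresh (Prod BarStrings One) e (v, ())" if "e \<notin> ub ` set v" for e v
    unfolding fresh_iff using that supports_Prod_BarStrings[of One "{}" "()" v "ub ` set v"]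
    by (intro exI[of _ "ub ` set v"]) (simp add: supports_def One_def)
  have "fresh (Prod BarStrings One) d (?w, ())"
    using fresh_act[OF nom _ fresh, of w d "\<langle>c \<leftrightarrow> a\<rangle>"] d by (simp add: swap_other One_def)
  moreover have "wact \<langle>d \<leftrightarrow> a\<rangle> w = wact \<langle>d \<leftrightarrow> c\<rangle> ?w"
  proof -
    have "\<langle>d \<leftrightarrow> c\<rangle> * \<langle>c \<leftrightarrow> a\<rangle> = \<langle>d \<leftrightarrow> a\<rangle> * \<langle>d \<leftrightarrow> c\<rangle>"
      using swap_conj[of "\<langle>d \<leftrightarrow> c\<rangle>" c a] swap_other[of a d c] assms d by auto
    then have "wact \<langle>d \<leftrightarrow> c\<rangle> ?w = wact \<langle>d \<leftrightarrow> a\<rangle> (wact \<langle>d \<leftrightarrow> c\<rangle> w)"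
      by (simp only: wact_times[symmetric])
    also have "wact \<langle>d \<leftrightarrow> c\<rangle> w = w"
      using assms(1) d by (intro wact_idle) (metis Un_iff swap_other)
    finally show ?thesis by simp
  qed
  ultimately have "((a, (w, ())), (c, (?w, ()))) \<in> abs_rel (Prod BarStrings One)"
    using d fresh[of d w] unfolding abs_rel_def
    by (auto simp: One_def simp del: map_map intro!: exI[of _ d])
  then have "abs_class (Prod BarStrings One) a (w, ()) = abs_class (Prod BarStrings One) c (?w, ())"
    by (subst abs_class_eq_iff[OF nom]) (simp_all add: One_def)
  then show ?thesis using alpha_step.intros[of "()" One "()" a w c ?w "[]"] by (simp add: One_def)
qed

lemma aeq_equivclp: "aeq w w' \<Longrightarrow> equivclp (alpha_step One) (w, ()) (w', ())"
proof (induction rule: aeq_induct)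
  case (Fr a w w')
  then show ?case using equivclp_alpha_step_Cons[of One "(w, ())" "(w', ())"] by simp
next
  case (Bar a b c w w')
  have "equivclp (alpha_step One) (Bar a # w, ()) (Bar c # wact \<langle>c \<leftrightarrow> a\<rangle> w, ())"
    using Bar.hyps by (intro r_into_equivclp alpha_step_swap)
  moreover have "equivclp (alpha_step One) (Bar c # wact \<langle>c \<leftrightarrow> a\<rangle> w, ()) (Bar c # wact \<langle>c \<leftrightarrow> b\<rangle> w', ())"
    using equivclp_alpha_step_Cons[OF Bar.IH, of "Bar c"] by simp
  moreover have "equivclp (alpha_step One) (Bar c # wact \<langle>c \<leftrightarrow> b\<rangle> w', ()) (Bar b # w', ())"
    using Bar.hyps by (intro equivclp_sym[OF r_into_equivclp] alpha_step_swap)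
  ultimately show ?case by (meson equivclp_trans)
qed simp

lemma alpha_class_eq_iff:
  "alpha_class X w x = alpha_class X w' y \<longleftrightarrow> equivclp (alpha_step X) (w, x) (w', y)"
proof
  assume eq: "alpha_class X w x = alpha_class X w' y"
  have "(w', y) \<in> alpha_class X w' y" by (simp add: alpha_class_def)
  then have "(w', y) \<in> alpha_class X w x" by (simp only: eq)
  then show "equivclp (alpha_step X) (w, x) (w', y)" by (simp add: alpha_class_def)
next
  assume "equivclp (alpha_step X) (w, x) (w', y)"
  then show "alpha_class X w x = alpha_class X w' y"
    unfolding alpha_class_def by (blast intro: equivclp_trans equivclp_sym)
qed

text \<open>Links the generated equivalence to the codes by de Bruijn levels, so that
  \<open>D\<close> can be computed from the sets \<open>DW w\<close>.\<close>

lemma alpha_class_One: "alpha_class One w () = alpha_class One w' () \<longleftrightarrow> aeq w w'"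
proof -
  have "aeq (fst p) (fst q)" if "equivclp (alpha_step One) p q" for p q
    using that
  proof (induction rule: equivclp_induct)
    case (step y z)
    then show ?case using alpha_step_aeq aeq_sym aeq_trans by metis
  qed simp
  from this[of "(w, ())" "(w', ())"] show ?thesis
    unfolding alpha_class_eq_iff fst_conv using aeq_equivclp by (rule iffI)
qed

lemma D_L: "D (L Q \<gamma> q) = (\<Union>w\<in>{w. \<exists>q'. run Q \<gamma> q w q'}. DW w)"
proof -
  have "D (L Q \<gamma> q) = {map ub w | w. \<exists>v. (\<exists>q'. run Q \<gamma> q v q') \<and> alpha_class One v () = alpha_class One w ()}"
    unfolding D_def L_def by (simp, metis)
  then show ?thesis unfolding alpha_class_One DW_def by blast
qed

section \<open>Behaviour of transition systems\<close>

lemma alpha_step_letter: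
  assumes "nominal X" "good_map X f" "alpha_step X p q \<or> alpha_step X q p" "p = ([s], x)"
  shows "\<exists>s' y. q = ([s'], y) \<and> y \<in> carrier X \<and> sem f (letter_trm s' y) = sem f (letter_trm s x)"
proof -
  note nomP = nominal_Prod_BarStrings[OF assms(1)]
  have "\<exists>a b u y. s = Bar a \<and> q = (Bar b # u, y) \<and>
      ((a, ([], x)), (b, (u, y))) \<in> abs_rel (Prod BarStrings X)"
    using assms(3)
  proof
    assume "alpha_step X p q"
    then show ?thesis
    proof cases
      case (1 x' y a v b u w)
      then have "w = []" "v = []" "s = Bar a" "x' = x" using assms(4) by (cases w; simp)+
      with 1 show ?thesis using abs_class_eq_iff[OF nomP, of "(u, y)"] by auto
    qed
  next
    assume "alpha_step X q p"
    then show ?thesis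
    proof cases
      case (1 y x' b u a v w)
      then have "w = []" "v = []" "s = Bar a" "x' = x" using assms(4) by (cases w; simp)+
      with 1 show ?thesis using abs_class_eq_iff[OF nomP, of "(u, y)" a "([], x)" b] by auto
    qed
  qed
  then obtain a b u y where s: "s = Bar a" and q: "q = (Bar b # u, y)"
    and rel: "((a, ([], x)), (b, (u, y))) \<in> abs_rel (Prod BarStrings X)" by blast
  have "u = []" using rel by (auto simp: abs_rel_def)
  with rel have rel': "((a, x), (b, y)) \<in> abs_rel X" by (simp add: abs_rel_Prod_Nil)
  then have "y \<in> carrier X" by (simp add: abs_rel_def)
  with \<open>u = []\<close> show ?thesis using s q abs_rel_absL[OF assms(2) rel'] by simp
qed

text \<open>Alpha-steps from a one-letter pair lead only to one-letter pairs and, at a bar, are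
  equalities of name abstractions. So the language does not depend on the pair that represents a
  class.\<close>

lemma alpha_class_letter:
  assumes "nominal X" "good_map X f" "x \<in> carrier X" "alpha_class X [s] x = alpha_class X [s'] y"
  shows "sem f (letter_trm s x) = sem f (letter_trm s' y)"
proof -
  have "\<exists>s' y. p = ([s'], y) \<and> y \<in> carrier X \<and> sem f (letter_trm s' y) = sem f (letter_trm s x)"
    if "equivclp (alpha_step X) ([s], x) p" for p
    using that
  proof (induction rule: equivclp_induct)
    case base
    then show ?case using assms(3) by blast
  next
    case (step p q)
    then show ?case using alpha_step_letter[OF assms(1,2) step.hyps(2)] by metis
  qed
  from this[of "([s'], y)"] show ?thesis using assms(4) by (simp add: alpha_class_eq_iff)
qed

lemma alpha_class_Bar:
  assumes "nominal X" "x \<in> carrier X" "y \<in> carrier X" "abs_class X a x = abs_class X b y"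
  shows "alpha_class X [Bar a] x = alpha_class X [Bar b] y"
proof -
  have "((a, x), (b, y)) \<in> abs_rel X" using assms abs_class_eq_iff by metis
  then have "abs_class (Prod BarStrings X) a ([], x) = abs_class (Prod BarStrings X) b ([], y)"
    using assms(3) by (subst abs_class_eq_iff[OF nominal_Prod_BarStrings[OF assms(1)]])
      (simp_all add: abs_rel_Prod_Nil)
  then have "alpha_step X ([Bar a], x) ([Bar b], y)"
    using alpha_step.intros[OF assms(2,3), of a "[]" b "[]" "[]"] by simp
  then show ?thesis by (simp add: alpha_class_eq_iff r_into_equivclp)
qed

section \<open>Terms, their classes and chosen representatives\<close>

lemma trm_act_letter: "trm_act f \<pi> (letter_trm s x) = letter_trm (letter_act \<pi> s) (f \<pi> x)"
  by (cases s) simp_all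

lemma set_letter_trm [simp]: "set_trm (letter_trm s x) = {x}"
  by (cases s) simp_all

lemma uniform_depth_letter: "uniform_depth (Suc 0) (letter_trm s x)"
  by (cases s) (auto intro: uniform_depth.intros)

lemma sem_sum_trm: "sem f (sum_trm ts) = (\<Union>t\<in>set ts. sem f t)"
  by (induction ts rule: sum_trm.induct) auto

lemma set_sum_trm: "set_trm (sum_trm ts) = (\<Union>t\<in>set ts. set_trm t)"
  by (induction ts rule: sum_trm.induct) auto

lemma uniform_depth_sum_trm:
  "(\<And>t. t \<in> set ts \<Longrightarrow> uniform_depth n t) \<Longrightarrow> uniform_depth n (sum_trm ts)"
  by (induction ts rule: sum_trm.induct) (auto intro: uniform_depth.intros)

lemma uniform_depth_subst:
  "uniform_depth m t \<Longrightarrow> (\<And>x. x \<in> set_trm t \<Longrightarrow> uniform_depth k (\<sigma> x)) \<Longrightarrow>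
    uniform_depth (m + k) (subst \<sigma> t)"
  by (induction rule: uniform_depth.induct) (auto intro: uniform_depth.intros)

lemma set_trm_subst: "set_trm (subst \<sigma> t) = (\<Union>x\<in>set_trm t. set_trm (\<sigma> x))"
  by (induction t) auto

lemma mem_cls: "u \<in> cls n X t \<longleftrightarrow> t \<in> carrier (Term n X) \<and> u \<in> carrier (Term n X) \<and> deriv X n t u"
  by (auto simp: cls_def deriv_rel_def)

lemma self_mem_cls: "t \<in> carrier (Term n X) \<Longrightarrow> t \<in> cls n X t"
  by (simp add: mem_cls deriv_refl Term_def)

lemma rep_cls: "t \<in> carrier (Term n X) \<Longrightarrow> rep (cls n X t) \<in> cls n X t"
  unfolding rep_def using self_mem_cls by (metis someI)

lemma carrier_M: "c \<in> carrier (M n X) \<longleftrightarrow> (\<exists>t\<in>carrier (Term n X). c = cls n X t)"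
  by (auto simp: M_def Quot_def quotient_def cls_def)

lemma sem1_cls:
  assumes "u \<in> cls n One t"
  shows "sem1 u = sem1 t"
proof -
  have "deriv One n t u" using assms by (simp add: mem_cls)
  from deriv_sound[OF this good_map_One] show ?thesis by (rule sym)
qed

lemma cls_One_eq_iff:
  assumes "uniform_depth n t" "uniform_depth n u"
  shows "cls n One t = cls n One u \<longleftrightarrow> sem1 t = sem1 u"
proof
  assume "cls n One t = cls n One u"
  then have "u \<in> cls n One t" using assms self_mem_cls[of u n One] by (simp add: carrier_Term_One)
  then show "sem1 t = sem1 u" by (simp add: sem1_cls)
next
  assume "sem1 t = sem1 u"
  then have "deriv One n t u" "deriv One n u t" using assms by (simp_all add: deriv_One_complete)
  then show "cls n One t = cls n One u"
    using assms by (auto simp: mem_cls carrier_Term_One intro: deriv.trans)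
qed

text \<open>The choice \<open>rep\<close> need not be equivariant, but all terms in a class have the
  same language, so the language of the chosen one is.\<close>

lemma good_map_M_One: "good_map (M n One) (\<lambda>c. sem1 (rep c))"
  unfolding good_map_def
proof (intro conjI ballI allI)
  fix c \<pi> assume "c \<in> carrier (M n One)"
  then obtain t where t: "t \<in> carrier (Term n One)" "c = cls n One t" by (auto simp: carrier_M)
  show "good (sem1 (rep c))" using good_DW[of "[]"] by (intro good_sem) simp
  have eq: "sem1 u = sem1 t" if "u \<in> c" for u
    using that t(2) by (simp add: sem1_cls)
  have act: "act (M n One) \<pi> c = trm_act (act One) \<pi> ` c"
    by (simp add: M_def Quot_def Term_def)
  have "trm_act (act One) \<pi> t \<in> act (M n One) \<pi> c"
    unfolding act using self_mem_cls[OF t(1)] t(2) by (intro imageI) simp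
  then have "rep (act (M n One) \<pi> c) \<in> act (M n One) \<pi> c" unfolding rep_def by (rule someI)
  then obtain u where u: "u \<in> c" "rep (act (M n One) \<pi> c) = trm_act (act One) \<pi> u"
    unfolding act by blast
  have "sem1 (trm_act (act One) \<pi> u) = lact \<pi> (sem1 u)"
    by (rule sem_act[OF good_map_One]) (simp add: One_def)
  also have "sem1 u = sem1 (rep c)" using eq[OF u(1)] eq[OF rep_cls[OF t(1), folded t(2)]] by simp
  finally show "sem1 (rep (act (M n One) \<pi> c)) = lact \<pi> (sem1 (rep c))" unfolding u(2) .
qed

section \<open>Languages of states by word length\<close>

text \<open>The recursion follows \<open>behaviour\<close> rather than runs: a transition is a
  depth-one term evaluated at the previous languages. \<open>Lang_good_runs\<close> and
  \<open>run_DW\<close> provide the link to runs.\<close>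

primrec Lang :: "'q gset \<Rightarrow> 'q coalg \<Rightarrow> nat \<Rightarrow> 'q \<Rightarrow> name list set" where
  "Lang Q \<gamma> 0 q = {[]}"
| "Lang Q \<gamma> (Suc n) q = \<Union> {sem (Lang Q \<gamma> n) (letter_trm s p) | s p. step Q \<gamma> q s p}"

context
  fixes Q :: "'q gset" and \<gamma> :: "'q coalg"
  assumes reg: "regular_nts Q \<gamma>"
begin

lemma nominal_Q: "nominal Q"
  using reg by (simp add: regular_nts_def)

lemma step_carrier: "step Q \<gamma> q s p \<Longrightarrow> p \<in> carrier Q"
  by (cases s) simp_all

lemma coalg_carrier:
  assumes "q \<in> carrier Q"
  shows "finite (fst (\<gamma> q))" "fst (\<gamma> q) \<subseteq> UNIV \<times> carrier Q" "finite (snd (\<gamma> q))"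
proof -
  have "\<gamma> q \<in> carrier (H Q)" using reg assms by (auto simp: regular_nts_def equivariant_def)
  then show "finite (fst (\<gamma> q))" "fst (\<gamma> q) \<subseteq> UNIV \<times> carrier Q" "finite (snd (\<gamma> q))"
    by (auto simp: H_def Prod_def Pfin_def Names_def)
qed

lemma alpha_steps:
  assumes "q \<in> carrier Q"
  shows "alpha Q (\<gamma> q) = (\<lambda>(s, p). alpha_class Q [s] p) ` {(s, p). step Q \<gamma> q s p}"
    (is "_ = ?g ` ?P")
proof
  show "alpha Q (\<gamma> q) \<subseteq> ?g ` ?P"
  proof
    fix C assume "C \<in> alpha Q (\<gamma> q)"
    then consider a p where "C = alpha_class Q [Fr a] p" "(a, p) \<in> fst (\<gamma> q)"
      | a p where "C = alpha_class Q [Bar a] p" "p \<in> carrier Q" "abs_class Q a p \<in> snd (\<gamma> q)"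
      unfolding alpha_def by (auto split: prod.splits)
    then show "C \<in> ?g ` ?P"
    proof cases
      case 1
      then have "(Fr a, p) \<in> ?P" using coalg_carrier(2)[OF assms] by auto
      then show ?thesis using 1 by (intro image_eqI[of _ _ "(Fr a, p)"]) simp_all
    next
      case 2
      then show ?thesis by (intro image_eqI[of _ _ "(Bar a, p)"]) simp_all
    qed
  qed
  show "?g ` ?P \<subseteq> alpha Q (\<gamma> q)"
  proof clarify
    fix s p assume "step Q \<gamma> q s p"
    then show "alpha_class Q [s] p \<in> alpha Q (\<gamma> q)"
      by (cases s) (auto simp: alpha_def split: prod.splits)
  qed
qed

text \<open>A bound transition has many representatives, but \<open>alpha_class Q [Bar a] p\<close>
  depends only on \<open>abs_class Q a p\<close>; \<open>h\<close> is the induced map on the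
  finitely many abstractions.\<close>

lemma finite_alpha:
  assumes "q \<in> carrier Q"
  shows "finite (alpha Q (\<gamma> q))"
proof -
  define h where "h C = (SOME D. \<exists>a p. p \<in> carrier Q \<and> abs_class Q a p = C \<and> D = alpha_class Q [Bar a] p)" for C
  have h: "alpha_class Q [Bar a] p = h (abs_class Q a p)" if "p \<in> carrier Q" for a p
  proof -
    have "\<exists>a' p'. p' \<in> carrier Q \<and> abs_class Q a' p' = abs_class Q a p \<and>
        h (abs_class Q a p) = alpha_class Q [Bar a'] p'"
      unfolding h_def by (rule someI[of _ "alpha_class Q [Bar a] p"]) (use that in blast)
    then show ?thesis using alpha_class_Bar[OF nominal_Q that] by metis
  qed
  have "alpha Q (\<gamma> q) \<subseteq> (\<lambda>(a, p). alpha_class Q [Fr a] p) ` fst (\<gamma> q) \<union> h ` snd (\<gamma> q)"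
    unfolding alpha_def using h by (auto split: prod.splits)
  then show ?thesis using coalg_carrier[OF assms] by (auto intro: finite_subset)
qed

text \<open>One transition for each of the finitely many alpha-classes suffices, because the
  language of a letter depends only on its class. The set \<open>P\<close> is chosen before
  \<open>f\<close>, so it serves all valuations.\<close>

lemma finite_steps:
  assumes "q \<in> carrier Q"
  obtains P where "finite P" "P \<subseteq> {(s, p). step Q \<gamma> q s p}"
    "\<And>f. good_map Q f \<Longrightarrow> \<Union> {sem f (letter_trm s p) | s p. step Q \<gamma> q s p} =
      (\<Union>(s, p)\<in>P. sem f (letter_trm s p))"
proof -
  obtain P where P: "finite P" "P \<subseteq> {(s, p). step Q \<gamma> q s p}"
    "alpha Q (\<gamma> q) = (\<lambda>(s, p). alpha_class Q [s] p) ` P"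
    using finite_subset_image[OF finite_alpha[OF assms], of "\<lambda>(s, p). alpha_class Q [s] p"
        "{(s, p). step Q \<gamma> q s p}"] alpha_steps[OF assms] by auto
  show thesis
  proof (rule that[OF P(1,2)])
    fix f assume f: "good_map Q f"
    show "\<Union> {sem f (letter_trm s p) | s p. step Q \<gamma> q s p} = (\<Union>(s, p)\<in>P. sem f (letter_trm s p))"
    proof
      show "\<Union> {sem f (letter_trm s p) | s p. step Q \<gamma> q s p} \<subseteq> (\<Union>(s, p)\<in>P. sem f (letter_trm s p))"
      proof
        fix v assume "v \<in> \<Union> {sem f (letter_trm s p) | s p. step Q \<gamma> q s p}"
        then obtain s p where v: "v \<in> sem f (letter_trm s p)" and st: "step Q \<gamma> q s p" by blast
        then have "alpha_class Q [s] p \<in> alpha Q (\<gamma> q)" unfolding alpha_steps[OF assms] by blast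
        then obtain s' p' where P': "(s', p') \<in> P" "alpha_class Q [s] p = alpha_class Q [s'] p'"
          unfolding P(3) by auto
        then have "sem f (letter_trm s p) = sem f (letter_trm s' p')"
          using alpha_class_letter[OF nominal_Q f step_carrier[OF st]] by blast
        with v P'(1) show "v \<in> (\<Union>(s, p)\<in>P. sem f (letter_trm s p))" by auto
      qed
    qed (use P(2) in blast)
  qed
qed

lemma step_act:
  assumes "q \<in> carrier Q" "step Q \<gamma> q s p"
  shows "step Q \<gamma> (act Q \<pi> q) (letter_act \<pi> s) (act Q \<pi> p)"
proof -
  have p: "p \<in> carrier Q" using assms(2) by (rule step_carrier)
  have "\<gamma> (act Q \<pi> q) = act (H Q) \<pi> (\<gamma> q)"
    using reg assms(1) by (simp add: regular_nts_def equivariant_def)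
  then have \<gamma>: "fst (\<gamma> (act Q \<pi> q)) = (\<lambda>(a, p). (\<pi> \<langle>$\<rangle> a, act Q \<pi> p)) ` fst (\<gamma> q)"
    "snd (\<gamma> (act Q \<pi> q)) = act (Abstr Q) \<pi> ` snd (\<gamma> q)"
    by (simp_all add: H_def Prod_def Pfin_def Names_def split_beta)
  show ?thesis
  proof (cases s)
    case (Fr a)
    then have "(a, p) \<in> fst (\<gamma> q)" using assms(2) by simp
    then have "(\<pi> \<langle>$\<rangle> a, act Q \<pi> p) \<in> fst (\<gamma> (act Q \<pi> q))"
      unfolding \<gamma> by (rule rev_image_eqI) simp
    then show ?thesis using Fr p act_closed[OF nominal_Q] by simp
  next
    case (Bar a)
    then have "abs_class Q a p \<in> snd (\<gamma> q)" using assms(2) by simp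
    then have "abs_class Q (\<pi> \<langle>$\<rangle> a) (act Q \<pi> p) \<in> snd (\<gamma> (act Q \<pi> q))"
      unfolding \<gamma> by (rule rev_image_eqI) (simp add: abs_class_act[OF nominal_Q p])
    then show ?thesis using Bar p act_closed[OF nominal_Q] by simp
  qed
qed

lemma Lang_act_subset:
  assumes "good_map Q (Lang Q \<gamma> n)" "q \<in> carrier Q"
  shows "lact \<pi> (Lang Q \<gamma> (Suc n) q) \<subseteq> Lang Q \<gamma> (Suc n) (act Q \<pi> q)"
proof
  fix v assume "v \<in> lact \<pi> (Lang Q \<gamma> (Suc n) q)"
  then obtain s p where v: "v \<in> lact \<pi> (sem (Lang Q \<gamma> n) (letter_trm s p))" and st: "step Q \<gamma> q s p"
    by auto
  have "v \<in> sem (Lang Q \<gamma> n) (letter_trm (letter_act \<pi> s) (act Q \<pi> p))"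
    using v sem_act[OF assms(1), of "letter_trm s p" \<pi>] step_carrier[OF st]
    by (simp add: trm_act_letter)
  then show "v \<in> Lang Q \<gamma> (Suc n) (act Q \<pi> q)" using step_act[OF assms(2) st] by auto
qed

definition runs :: "nat \<Rightarrow> 'q \<Rightarrow> letter list set" where
  "runs n q = {w. length w = n \<and> (\<exists>q'. run Q \<gamma> q w q')}"

text \<open>The two claims need a joint induction: \<open>finite_steps\<close> for the next level
  requires the valuation of this level to be a \<open>good_map\<close>, and goodness of the next
  level comes from its finite set of generators. That the generators are labels of actual runs gives
  one inclusion in \<open>D_L_Lang\<close>.\<close>

lemma Lang_good_runs:
  "good_map Q (Lang Q \<gamma> n) \<and>
   (\<forall>q\<in>carrier Q. \<exists>W. finite W \<and> W \<subseteq> runs n q \<and> Lang Q \<gamma> n q = (\<Union>w\<in>W. DW w))"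
proof (induction n)
  case 0
  have "good {[]}" using good_DW[of "[]"] by simp
  moreover have "[] \<in> runs 0 q" for q
  proof -
    have "run Q \<gamma> q [] q" by simp
    then show ?thesis unfolding runs_def by (metis (mono_tags) list.size(3) mem_Collect_eq)
  qed
  ultimately show ?case by (auto simp: good_map_def intro!: exI[of _ "{[]}"])
next
  case (Suc n)
  then have gm: "good_map Q (Lang Q \<gamma> n)" by blast
  obtain V where V: "\<And>q. q \<in> carrier Q \<Longrightarrow> finite (V q)" "\<And>q. q \<in> carrier Q \<Longrightarrow> V q \<subseteq> runs n q"
    "\<And>q. q \<in> carrier Q \<Longrightarrow> Lang Q \<gamma> n q = (\<Union>w\<in>V q. DW w)"
    using Suc by metis
  have letter: "sem (Lang Q \<gamma> n) (letter_trm s p) = (\<Union>w\<in>(#) s ` V p. DW w)" if "p \<in> carrier Q" for s p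
    using that V by (cases s) (auto simp: DW_Fr absL_UN)
  have W: "\<exists>W. finite W \<and> W \<subseteq> runs (Suc n) q \<and> Lang Q \<gamma> (Suc n) q = (\<Union>w\<in>W. DW w)"
    if q: "q \<in> carrier Q" for q
  proof -
    obtain P where P: "finite P" "P \<subseteq> {(s, p). step Q \<gamma> q s p}"
      "\<And>f. good_map Q f \<Longrightarrow> \<Union> {sem f (letter_trm s p) | s p. step Q \<gamma> q s p} =
      (\<Union>(s, p)\<in>P. sem f (letter_trm s p))" using finite_steps[OF q] by blast
    have car: "p \<in> carrier Q" if "(s, p) \<in> P" for s p using P(2) that step_carrier by blast
    let ?W = "\<Union>(s, p)\<in>P. (#) s ` V p"
    have "finite ?W" using P(1) V(1) car by auto
    moreover have "?W \<subseteq> runs (Suc n) q"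
    proof clarify
      fix s p w assume sp: "(s, p) \<in> P" and "w \<in> V p"
      then obtain q' where w: "length w = n" "run Q \<gamma> p w q'"
        using V(2)[OF car[OF sp]] by (auto simp: runs_def)
      have "step Q \<gamma> q s p" using P(2) sp by blast
      with w have "length (s # w) = Suc n" "run Q \<gamma> q (s # w) q'" by auto
      then show "s # w \<in> runs (Suc n) q" unfolding runs_def by blast
    qed
    moreover have "Lang Q \<gamma> (Suc n) q = (\<Union>w\<in>?W. DW w)"
    proof -
      have "Lang Q \<gamma> (Suc n) q = (\<Union>(s, p)\<in>P. sem (Lang Q \<gamma> n) (letter_trm s p))"
        using P(3)[OF gm] by simp
      also have "\<dots> = (\<Union>(s, p)\<in>P. \<Union>w\<in>(#) s ` V p. DW w)"
      proof (rule SUP_cong[OF HOL.refl])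
        fix x assume "x \<in> P"
        then show "(case x of (s, p) \<Rightarrow> sem (Lang Q \<gamma> n) (letter_trm s p)) =
            (case x of (s, p) \<Rightarrow> \<Union>w\<in>(#) s ` V p. DW w)"
          using letter[OF car] by (cases x) simp
      qed
      finally show ?thesis by (simp only: case_prod_unfold UN_UN_flatten)
    qed
    ultimately show ?thesis by blast
  qed
  have "good_map Q (Lang Q \<gamma> (Suc n))"
    unfolding good_map_def
  proof (intro conjI ballI allI)
    fix q \<pi> assume q: "q \<in> carrier Q"
    show "good (Lang Q \<gamma> (Suc n) q)" unfolding good_def using W[OF q] by blast
    note \<pi>q = act_closed[OF nominal_Q q]
    have "Lang Q \<gamma> (Suc n) (act Q \<pi> q) = lact \<pi> (lact (inverse \<pi>) (Lang Q \<gamma> (Suc n) (act Q \<pi> q)))"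
      by (simp only: lact_times[symmetric] perm.right_inverse lact_one)
    also have "\<dots> \<subseteq> lact \<pi> (Lang Q \<gamma> (Suc n) (act Q (inverse \<pi>) (act Q \<pi> q)))"
      by (intro image_mono Lang_act_subset gm \<pi>q)
    also have "act Q (inverse \<pi>) (act Q \<pi> q) = q"
      by (simp add: act_times[OF nominal_Q q, symmetric] act_one[OF nominal_Q q])
    finally show "Lang Q \<gamma> (Suc n) (act Q \<pi> q) = lact \<pi> (Lang Q \<gamma> (Suc n) q)"
      using Lang_act_subset[OF gm q] by blast
  qed
  with W show ?case by blast
qed

lemma Lang_length: "q \<in> carrier Q \<Longrightarrow> v \<in> Lang Q \<gamma> n q \<Longrightarrow> length v = n"
proof -
  assume "q \<in> carrier Q" "v \<in> Lang Q \<gamma> n q"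
  then obtain w where "w \<in> runs n q" "v \<in> DW w" using Lang_good_runs[of n] by blast
  then show ?thesis by (simp add: runs_def DW_length)
qed

lemma run_DW: "run Q \<gamma> q w q' \<Longrightarrow> DW w \<subseteq> Lang Q \<gamma> (length w) q"
proof (induction w arbitrary: q)
  case (Cons s w)
  then obtain p where st: "step Q \<gamma> q s p" and IH: "DW w \<subseteq> Lang Q \<gamma> (length w) p" by auto
  have "DW (s # w) \<subseteq> sem (Lang Q \<gamma> (length w)) (letter_trm s p)"
    using IH by (cases s) (auto simp: DW_Fr absL_def)
  then show ?case using st by auto
qed simp

lemma D_L_Lang: "q \<in> carrier Q \<Longrightarrow> D (L Q \<gamma> q) = (\<Union>n. Lang Q \<gamma> n q)"
proof
  show "D (L Q \<gamma> q) \<subseteq> (\<Union>n. Lang Q \<gamma> n q)" unfolding D_L using run_DW by blast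
  assume q: "q \<in> carrier Q"
  show "(\<Union>n. Lang Q \<gamma> n q) \<subseteq> D (L Q \<gamma> q)"
  proof (rule UN_least)
    fix n
    obtain W where W: "W \<subseteq> runs n q" "Lang Q \<gamma> n q = (\<Union>w\<in>W. DW w)"
      using Lang_good_runs[of n] q by blast
    have "runs n q \<subseteq> {w. \<exists>q'. run Q \<gamma> q w q'}" by (auto simp: runs_def)
    with W(1) have "W \<subseteq> {w. \<exists>q'. run Q \<gamma> q w q'}" by (rule subset_trans)
    then show "Lang Q \<gamma> n q \<subseteq> D (L Q \<gamma> q)" unfolding D_L W(2) by (rule UN_mono) simp
  qed
qed

section \<open>The behaviour maps compute the languages\<close>

text \<open>\<open>theta1\<close> chooses one pair for each class, and such a pair is only known to
  be alpha-equivalent to a transition. Languages are therefore compared through classes, in both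
  directions.\<close>

lemma theta1_alpha:
  assumes q: "q \<in> carrier Q"
  obtains t where "theta1 Q (alpha Q (\<gamma> q)) = cls 1 Q t" "t \<in> carrier (Term 1 Q)"
    "\<And>f. good_map Q f \<Longrightarrow> sem f t = \<Union> {sem f (letter_trm s p) | s p. step Q \<gamma> q s p}"
proof -
  let ?g = "\<lambda>(s, x). alpha_class Q [s] x"
  let ?ok = "\<lambda>ps. set ps \<subseteq> UNIV \<times> carrier Q \<and> distinct (map ?g ps) \<and> set (map ?g ps) = alpha Q (\<gamma> q)"
  define ps where "ps = (SOME ps. ?ok ps)"
  \<comment> \<open>A list as required by the choice in \<open>theta1\<close> exists: there are
    finitely many classes, and each is represented by a transition.\<close>
  obtain Cs where Cs: "set Cs = alpha Q (\<gamma> q)" "distinct Cs"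
    using finite_distinct_list[OF finite_alpha[OF q]] by blast
  have "\<exists>r. r \<in> UNIV \<times> carrier Q \<and> ?g r = C" if C: "C \<in> set Cs" for C
  proof -
    obtain s p where "step Q \<gamma> q s p" "C = alpha_class Q [s] p"
      using C unfolding Cs(1) alpha_steps[OF q] by auto
    then show ?thesis using step_carrier by (intro exI[of _ "(s, p)"]) simp
  qed
  then obtain r where r: "\<And>C. C \<in> set Cs \<Longrightarrow> r C \<in> UNIV \<times> carrier Q \<and> ?g (r C) = C" by metis
  then have gr: "map ?g (map r Cs) = Cs" by (simp add: map_idI)
  have "set (map r Cs) \<subseteq> UNIV \<times> carrier Q"
    unfolding set_map using r by (intro image_subsetI) blast
  then have "?ok (map r Cs)" unfolding gr using Cs by blast
  then have ok: "?ok ps" unfolding ps_def by (rule someI)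
  then have sets: "?g ` set ps = alpha Q (\<gamma> q)" by simp
  let ?t = "sum_trm (map (\<lambda>(s, x). letter_trm s x) ps)"
  show thesis
  proof (rule that)
    show "theta1 Q (alpha Q (\<gamma> q)) = cls 1 Q ?t"
      unfolding theta1_def ps_def Let_def ..
    show "?t \<in> carrier (Term 1 Q)"
      using ok by (auto simp: Term_def set_sum_trm uniform_depth_letter intro!: uniform_depth_sum_trm)
    fix f assume f: "good_map Q f"
    have 1: "\<exists>s' p'. step Q \<gamma> q s' p' \<and> sem f (letter_trm s p) = sem f (letter_trm s' p')"
      if "(s, p) \<in> set ps" for s p
    proof -
      have "alpha_class Q [s] p \<in> alpha Q (\<gamma> q)" unfolding sets[symmetric] using that by force
      moreover have p: "p \<in> carrier Q" using ok that by auto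
      ultimately obtain s' p' where "step Q \<gamma> q s' p'" "alpha_class Q [s] p = alpha_class Q [s'] p'"
        unfolding alpha_steps[OF q] by auto
      then show ?thesis using alpha_class_letter[OF nominal_Q f p] by blast
    qed
    have 2: "\<exists>(s', p')\<in>set ps. sem f (letter_trm s p) = sem f (letter_trm s' p')"
      if "step Q \<gamma> q s p" for s p
    proof -
      have "alpha_class Q [s] p \<in> alpha Q (\<gamma> q)" unfolding alpha_steps[OF q] using that by blast
      then obtain s' p' where "(s', p') \<in> set ps" "alpha_class Q [s] p = alpha_class Q [s'] p'"
        unfolding sets[symmetric] by auto
      then show ?thesis
        using alpha_class_letter[OF nominal_Q f step_carrier[OF that]] by blast
    qed
    have "sem f ?t = (\<Union>(s, p)\<in>set ps. sem f (letter_trm s p))"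
      by (auto simp: sem_sum_trm)
    also have "\<dots> = \<Union> {sem f (letter_trm s p) | s p. step Q \<gamma> q s p}"
    proof
      show "(\<Union>(s, p)\<in>set ps. sem f (letter_trm s p)) \<subseteq> \<Union> {sem f (letter_trm s p) | s p. step Q \<gamma> q s p}"
      proof
        fix v assume "v \<in> (\<Union>(s, p)\<in>set ps. sem f (letter_trm s p))"
        then obtain s p where sp: "(s, p) \<in> set ps" "v \<in> sem f (letter_trm s p)" by auto
        obtain s' p' where "step Q \<gamma> q s' p'" "v \<in> sem f (letter_trm s' p')"
          using 1[OF sp(1)] sp(2) by auto
        then show "v \<in> \<Union> {sem f (letter_trm s p) | s p. step Q \<gamma> q s p}" by blast
      qed
      show "\<Union> {sem f (letter_trm s p) | s p. step Q \<gamma> q s p} \<subseteq> (\<Union>(s, p)\<in>set ps. sem f (letter_trm s p))"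
      proof
        fix v assume "v \<in> \<Union> {sem f (letter_trm s p) | s p. step Q \<gamma> q s p}"
        then obtain s p where sp: "step Q \<gamma> q s p" "v \<in> sem f (letter_trm s p)" by blast
        then show "v \<in> (\<Union>(s, p)\<in>set ps. sem f (letter_trm s p))" using 2[OF sp(1)] by auto
      qed
    qed
    finally show "sem f ?t = \<Union> {sem f (letter_trm s p) | s p. step Q \<gamma> q s p}" .
  qed
qed

text \<open>Each \<open>rep\<close> replaces a term by a derivably equal one, and soundness hides
  the replacement. In the induction step the valuations are \<open>Lang Q \<gamma> n\<close> over
  \<open>Q\<close> and the language of the chosen term over \<open>M n One\<close>; composing the
  latter with the behaviour map of depth \<open>n\<close> gives the former on
  \<open>carrier Q\<close>.\<close>

lemma behaviour_Lang:
  "q \<in> carrier Q \<Longrightarrow> \<exists>t. uniform_depth n t \<and> behaviour Q \<gamma> n q = cls n One t \<and> sem1 t = Lang Q \<gamma> n q"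
proof (induction n arbitrary: q)
  case 0
  have q: "Var q \<in> carrier (Term 0 Q)" using 0 by (simp add: Term_def uniform_depth.intros)
  define t where "t = rep (eta Q q)"
  have t: "t \<in> cls 0 Q (Var q)" unfolding t_def eta_def using rep_cls[OF q] .
  have "good_map Q (\<lambda>_. {[]})" using good_DW[of "[]"] by (simp add: good_map_def)
  then have "sem (\<lambda>_. {[]}) t = {[]}"
    using t deriv_sound[of Q 0 "Var q" t "\<lambda>_. {[]}"] by (simp add: mem_cls)
  then have "sem1 (subst (\<lambda>_. Var ()) t) = {[]}" by (simp add: sem_subst)
  moreover have "uniform_depth 0 (subst (\<lambda>_. Var ()) t)"
    using t uniform_depth_subst[of 0 t 0 "\<lambda>_. Var ()"]
    by (simp add: mem_cls Term_def uniform_depth.intros)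
  ultimately show ?case by (intro exI[of _ "subst (\<lambda>_. Var ()) t"]) (simp add: M_map_def t_def)
next
  case (Suc n)
  let ?b = "behaviour Q \<gamma> n"
  have b: "?b p \<in> carrier (M n One)" "sem1 (rep (?b p)) = Lang Q \<gamma> n p" if p: "p \<in> carrier Q" for p
  proof -
    obtain t where t: "uniform_depth n t" "?b p = cls n One t" "sem1 t = Lang Q \<gamma> n p"
      using Suc.IH[OF p] by blast
    have tc: "t \<in> carrier (Term n One)" using t(1) by (simp add: carrier_Term_One)
    then show "?b p \<in> carrier (M n One)" using t(2) by (auto simp: carrier_M)
    show "sem1 (rep (?b p)) = Lang Q \<gamma> n p"
      using sem1_cls[OF rep_cls[OF tc]] t(2,3) by simp
  qed
  obtain t where t: "theta1 Q (alpha Q (\<gamma> q)) = cls 1 Q t" "t \<in> carrier (Term 1 Q)"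
    "\<And>f. good_map Q f \<Longrightarrow> sem f t = \<Union> {sem f (letter_trm s p) | s p. step Q \<gamma> q s p}"
    using theta1_alpha[OF Suc.prems] by blast
  have gm: "good_map Q (Lang Q \<gamma> n)" using Lang_good_runs by blast
  define t\<^sub>1 where "t\<^sub>1 = rep (cls 1 Q t)"
  have t\<^sub>1: "t\<^sub>1 \<in> carrier (Term 1 Q)" "deriv Q 1 t t\<^sub>1"
    using rep_cls[OF t(2)] by (simp_all add: t\<^sub>1_def mem_cls)
  define t\<^sub>2 where "t\<^sub>2 = subst (\<lambda>x. Var (?b x)) t\<^sub>1"
  have t\<^sub>2: "t\<^sub>2 \<in> carrier (Term 1 (M n One))"
    using t\<^sub>1(1) b(1) uniform_depth_subst[of 1 t\<^sub>1 0 "\<lambda>x. Var (?b x)"]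
    by (auto simp: t\<^sub>2_def Term_def set_trm_subst uniform_depth.intros)
  define t\<^sub>3 where "t\<^sub>3 = rep (cls 1 (M n One) t\<^sub>2)"
  have t\<^sub>3: "t\<^sub>3 \<in> carrier (Term 1 (M n One))" "deriv (M n One) 1 t\<^sub>2 t\<^sub>3"
    using rep_cls[OF t\<^sub>2] by (simp_all add: t\<^sub>3_def mem_cls)
  have "uniform_depth n (rep c)" if "c \<in> carrier (M n One)" for c
    using that rep_cls[of _ n One] by (auto simp: carrier_M mem_cls carrier_Term_One)
  then have ud: "uniform_depth (Suc n) (subst rep t\<^sub>3)"
    using t\<^sub>3(1) uniform_depth_subst[of 1 t\<^sub>3 n rep] by (auto simp: Term_def)
  have "sem1 (subst rep t\<^sub>3) = sem (\<lambda>c. sem1 (rep c)) t\<^sub>2"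
    using deriv_sound[OF t\<^sub>3(2) good_map_M_One] by (simp add: sem_subst)
  also have "\<dots> = sem (\<lambda>p. sem1 (rep (?b p))) t\<^sub>1" by (simp add: t\<^sub>2_def sem_subst)
  also have "\<dots> = sem (Lang Q \<gamma> n) t\<^sub>1"
    using t\<^sub>1(1) b(2) by (intro sem_cong) (auto simp: Term_def)
  also have "\<dots> = sem (Lang Q \<gamma> n) t" using deriv_sound[OF t\<^sub>1(2) gm] by simp
  also have "\<dots> = Lang Q \<gamma> (Suc n) q" using t(3)[OF gm] by simp
  finally have "sem1 (subst rep t\<^sub>3) = Lang Q \<gamma> (Suc n) q" .
  moreover have "behaviour Q \<gamma> (Suc n) q = cls (Suc n) One (subst rep t\<^sub>3)"
    by (simp add: mu_def M_map_def t(1) t\<^sub>3_def t\<^sub>2_def t\<^sub>1_def)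
  ultimately show ?case using ud by blast
qed

end

lemma behaviour_eq_iff:
  assumes "regular_nts Q \<gamma>" "regular_nts Q' \<delta>" "x \<in> carrier Q" "y \<in> carrier Q'"
  shows "behaviour Q \<gamma> n x = behaviour Q' \<delta> n y \<longleftrightarrow> Lang Q \<gamma> n x = Lang Q' \<delta> n y"
proof -
  obtain t where "uniform_depth n t" "behaviour Q \<gamma> n x = cls n One t" "sem1 t = Lang Q \<gamma> n x"
    using behaviour_Lang[OF assms(1,3)] by blast
  moreover obtain u where "uniform_depth n u" "behaviour Q' \<delta> n y = cls n One u" "sem1 u = Lang Q' \<delta> n y"
    using behaviour_Lang[OF assms(2,4)] by blast
  ultimately show ?thesis using cls_One_eq_iff by metis
qed


theorem theorem6:
  fixes Q :: "'p gset" and \<gamma> :: "'p coalg"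
    and Q' :: "'q gset" and \<delta> :: "'q coalg"
    and x :: 'p and y :: 'q
  assumes "regular_nts Q \<gamma>" and "regular_nts Q' \<delta>"
    and "x \<in> carrier Q" and "y \<in> carrier Q'"
  shows "D (L Q \<gamma> x) = D (L Q' \<delta> y) \<longleftrightarrow>
         (\<forall>n. behaviour Q \<gamma> n x = behaviour Q' \<delta> n y)"
proof -
  \<comment> \<open>Words of depth \<open>n\<close> have length \<open>n\<close>, so each level can
    be recovered from the union of all levels.\<close>
  have len: "Lang Q \<gamma> n x = {v \<in> D (L Q \<gamma> x). length v = n}" for n
    using D_L_Lang[OF assms(1,3)] Lang_length[OF assms(1,3)] by auto
  have len': "Lang Q' \<delta> n y = {v \<in> D (L Q' \<delta> y). length v = n}" for n
    using D_L_Lang[OF assms(2,4)] Lang_length[OF assms(2,4)] by auto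
  have "D (L Q \<gamma> x) = D (L Q' \<delta> y) \<longleftrightarrow> (\<forall>n. Lang Q \<gamma> n x = Lang Q' \<delta> n y)"
  proof
    assume "D (L Q \<gamma> x) = D (L Q' \<delta> y)"
    then show "\<forall>n. Lang Q \<gamma> n x = Lang Q' \<delta> n y" by (simp add: len len')
  next
    assume "\<forall>n. Lang Q \<gamma> n x = Lang Q' \<delta> n y"
    then show "D (L Q \<gamma> x) = D (L Q' \<delta> y)"
      by (simp add: D_L_Lang[OF assms(1,3)] D_L_Lang[OF assms(2,4)])
  qed
  then show ?thesis using behaviour_eq_iff[OF assms] by simp
qed

end
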